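(* Suppose the arrival rate is constant, $\lambda(t)=\lambda>0$, and that the occupancy time distributions have exponentially bounded tails, i.e. there exist $\delta>0$ and $t_0>0$ such that $Q_j(\tau)\le e^{-\delta\tau}$ for all $\tau\ge t_0$ and all $j\in\{1,\dots,J\}$. Then the network is ergodic if $\mathbb{E}[\log(S_1+\dots+S_J+1)]<\infty$.
   Context: Consider an open network of $J$ infinite server queues, indexed $1,\dots,J$, empty at time $0$. Batches arrive at the points $T_1,T_2,\dots$ of a homogeneous Poisson process on $[0,\infty)$ with rate $\lambda>0$. At time $T_i$, $\Sigma_{ij}$ customers arrive at queue $j$, for $j=1,\dots,J$. The vectors $\mathbf{\Sigma}_i=(\Sigma_{i1},\dots,\Sigma_{iJ})$, with non-negative integer components, are i.i.d. (and independent of the arrival times), with the same distribution as a generic vector $\mathbf{S}=(S_1,\dots,S_J)$. The $\ell$th customer entering queue $j$ at time $T_i$ carries a stochastic process $X^j_{i,\ell}(t)$, $t\ge 0$, where $X^j_{i,\ell}(t)=k\in\{1,\dots,J\}$ means that the customer is in queue $k$ at time $T_i+t$ (and $X^j_{i,\ell}(t)\notin\{1,\dots,J\}$ if the customer has left the network; customers that have left do not return). These processes are mutually independent and independent of the arrival times and batch sizes (conditionally on the node of entry), with $P(X^j_{i,\ell}(t)=k)=q^j_k(t)$ (measurable in $t$). Put $Q_j(t)=\sum_{k=1}^J q^j_k(t)$, the probability that a customer who entered at queue $j$ is still in the network a time $t$ after arrival. $\mathbf{N}(t)=(N_1(t),\dots,N_J(t))$ is the vector of numbers of customers in each queue at time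 $t$. The network is called ergodic if, as $t\to\infty$, $\mathbf{N}(t)$ converges in distribution to a proper probability distribution on $\mathbb{Z}_{\ge 0}^J$. *)

theory Defs
  imports "HOL-Probability.Probability"
begin

text \<open>
  The queues are the elements of a finite type 'j, so J is the cardinality of 'j and a vector with
  components indexed by the queues is an element of nat ^ 'j.  Arrival epochs, batches and the
  customers of a batch are numbered from 0.
\<close>

fun interarrival :: "(nat \<Rightarrow> 'w \<Rightarrow> real) \<Rightarrow> nat \<Rightarrow> 'w \<Rightarrow> real" where
  "interarrival T 0 \<omega> = T 0 \<omega>"
| "interarrival T (Suc i) \<omega> = T (Suc i) \<omega> - T i \<omega>"

definition poisson_points :: "'w measure \<Rightarrow> real \<Rightarrow> (nat \<Rightarrow> 'w \<Rightarrow> real) \<Rightarrow> bool" where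
  "poisson_points M lam T \<longleftrightarrow>
     prob_space.indep_vars M (\<lambda>_. borel) (interarrival T) UNIV \<and>
     (\<forall>i. distributed M lborel (interarrival T i) (exponential_density lam))"

text \<open>The sigma-algebra generated by the variables \<open>Y t\<close>, \<open>t \<ge> 0\<close>.\<close>

definition history :: "'w measure \<Rightarrow> (real \<Rightarrow> 'w \<Rightarrow> 'a) \<Rightarrow> 'w measure" where
  "history M Y =
     vimage_algebra (space M) (\<lambda>\<omega>. \<lambda>t\<in>{0..}. Y t \<omega>) (\<Pi>\<^sub>M t\<in>{0..}. count_space UNIV)"

text \<open>
  The mutually independent sources of randomness: the whole sequence of arrival epochs, each batch
  vector, and the itinerary of each customer.
\<close>

datatype 'j source = Arrivals | Batch nat | Customer nat 'j nat

fun source_algebra ::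
  "'w measure \<Rightarrow> (nat \<Rightarrow> 'w \<Rightarrow> real) \<Rightarrow> (nat \<Rightarrow> 'w \<Rightarrow> nat ^ 'j::finite) \<Rightarrow>
   (nat \<Rightarrow> 'j \<Rightarrow> nat \<Rightarrow> real \<Rightarrow> 'w \<Rightarrow> 'j option) \<Rightarrow> 'j source \<Rightarrow> 'w measure" where
  "source_algebra M T \<Sigma> X Arrivals =
     vimage_algebra (space M) (\<lambda>\<omega> i. T i \<omega>) (\<Pi>\<^sub>M i\<in>UNIV. borel)"
| "source_algebra M T \<Sigma> X (Batch i) = vimage_algebra (space M) (\<Sigma> i) (count_space UNIV)"
| "source_algebra M T \<Sigma> X (Customer i j l) = history M (X i j l)"

text \<open>
  \<open>X i j l t \<omega>\<close> is the position, \<open>t\<close> time units after \<open>T i \<omega>\<close>, of customer \<open>l\<close> entering queue \<open>j\<close>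
  with batch \<open>i\<close>; the value \<open>None\<close> means that this customer has left the network.  It is defined for
  all \<open>l\<close>, and only the customers with \<open>l < \<Sigma> i \<omega> $ j\<close> exist.

  In \<open>X_measurable\<close> joint measurability is required relative to the sigma-algebra generated by the
  process itself, as holds for right-continuous paths.  Joint measurability relative to \<open>M\<close> would
  not suffice: with \<open>U\<close> uniformly distributed on the unit interval, the process \<open>Y t \<omega> = (t = U \<omega>)\<close>
  is jointly measurable and, each \<open>Y t\<close> being almost surely false, independent of \<open>U\<close>, but
  \<open>Y (U \<omega>) \<omega>\<close> is always true.  The position of a customer at an independent random time must
  have the law obtained by averaging \<open>q\<close>.
\<close>

locale batch_network = prob_space M
  for M :: "'w measure" +
  fixes lam :: real
    and T :: "nat \<Rightarrow> 'w \<Rightarrow> real"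
    and \<Sigma> :: "nat \<Rightarrow> 'w \<Rightarrow> nat ^ 'j::finite"
    and S :: "'w \<Rightarrow> nat ^ 'j"
    and X :: "nat \<Rightarrow> 'j \<Rightarrow> nat \<Rightarrow> real \<Rightarrow> 'w \<Rightarrow> 'j option"
    and q :: "'j \<Rightarrow> 'j \<Rightarrow> real \<Rightarrow> real"
  assumes lam_pos: "lam > 0"
    and arrivals: "poisson_points M lam T"
    and S_random: "random_variable (count_space UNIV) S"
    and \<Sigma>_random: "\<And>i. random_variable (count_space UNIV) (\<Sigma> i)"
    and \<Sigma>_distr: "\<And>i. distr M (count_space UNIV) (\<Sigma> i) = distr M (count_space UNIV) S"
    and X_random: "\<And>i j l t. t \<ge> 0 \<Longrightarrow> random_variable (count_space UNIV) (X i j l t)"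
    and X_measurable: "\<And>i j l. (\<lambda>(t, \<omega>). X i j l t \<omega>) \<in>
          measurable (restrict_space borel {0..} \<Otimes>\<^sub>M history M (X i j l)) (count_space UNIV)"
    and X_prob: "\<And>i j l k t. t \<ge> 0 \<Longrightarrow> prob {\<omega> \<in> space M. X i j l t \<omega> = Some k} = q j k t"
    and q_measurable: "\<And>j k. q j k \<in> borel_measurable (restrict_space borel {0..})"
    and no_return: "\<And>i j l. AE \<omega> in M. \<forall>s t. 0 \<le> s \<longrightarrow> s \<le> t \<longrightarrow>
          X i j l s \<omega> = None \<longrightarrow> X i j l t \<omega> = None"
    and independent: "indep_sets (\<lambda>a. sets (source_algebra M T \<Sigma> X a)) UNIV"

definition occupancy_tail :: "('j::finite \<Rightarrow> 'j \<Rightarrow> real \<Rightarrow> real) \<Rightarrow> 'j \<Rightarrow> real \<Rightarrow> real" where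
  "occupancy_tail q j t = (\<Sum>k\<in>UNIV. q j k t)"

text \<open>Almost surely only finitely many batches arrive up to \<open>t\<close>, so the set below is finite.\<close>

definition queue_lengths ::
  "(nat \<Rightarrow> 'w \<Rightarrow> real) \<Rightarrow> (nat \<Rightarrow> 'w \<Rightarrow> nat ^ 'j::finite) \<Rightarrow>
   (nat \<Rightarrow> 'j \<Rightarrow> nat \<Rightarrow> real \<Rightarrow> 'w \<Rightarrow> 'j option) \<Rightarrow> real \<Rightarrow> 'w \<Rightarrow> nat ^ 'j" where
  "queue_lengths T \<Sigma> X t \<omega> =
     (\<chi> k. card {(i, j, l). T i \<omega> \<le> t \<and> l < \<Sigma> i \<omega> $ j \<and> X i j l (t - T i \<omega>) \<omega> = Some k})"

definition converges_in_distribution ::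
  "'w measure \<Rightarrow> (real \<Rightarrow> 'w \<Rightarrow> 'a::topological_space) \<Rightarrow> 'a measure \<Rightarrow> bool" where
  "converges_in_distribution M Y \<mu> \<longleftrightarrow>
     (\<forall>t\<ge>0. Y t \<in> borel_measurable M) \<and>
     (\<forall>f :: 'a \<Rightarrow> real. continuous_on UNIV f \<longrightarrow> bounded (range f) \<longrightarrow>
        ((\<lambda>t. \<integral>\<omega>. f (Y t \<omega>) \<partial>M) \<longlongrightarrow> (\<integral>y. f y \<partial>\<mu>)) at_top)"

definition ergodic ::
  "'w measure \<Rightarrow> (nat \<Rightarrow> 'w \<Rightarrow> real) \<Rightarrow> (nat \<Rightarrow> 'w \<Rightarrow> nat ^ 'j::finite) \<Rightarrow>
   (nat \<Rightarrow> 'j \<Rightarrow> nat \<Rightarrow> real \<Rightarrow> 'w \<Rightarrow> 'j option) \<Rightarrow> bool" where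
  "ergodic M T \<Sigma> X \<longleftrightarrow>
     (\<exists>\<pi> :: (nat ^ 'j) pmf. converges_in_distribution M (queue_lengths T \<Sigma> X) (measure_pmf \<pi>))"

end

theory Submission
  imports Defs
begin

text \<open>
  Let \<open>N t\<close> be the vector of queue lengths and \<open>F t\<close> the mean of \<open>f (N t)\<close>, for a function \<open>f\<close>
  with values between \<open>-1\<close> and \<open>1\<close>.  The proof shows that \<open>F\<close> satisfies the Cauchy criterion at
  infinity with a rate that is the same for all such \<open>f\<close>; the laws of \<open>N t\<close> are then Cauchy in
  total variation, so they converge to a probability distribution and no mass escapes.

  The rate comes from a renewal argument.  If the first batch arrives at time \<open>s \<le> t\<close>, then
  \<open>N t\<close> is the sum of what remains of this batch at age \<open>t - s\<close> and of the queue lengths, at time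
  \<open>t - s\<close>, of the network that starts afresh at \<open>s\<close>; if it arrives after \<open>t\<close>, then \<open>N t = 0\<close>.
  The fresh network is again a batch network with the same parameters, and the first arrival time is
  exponential and independent of everything else, so \<open>F t\<close> is the mean of \<open>G (t - s)\<close> over an
  exponential \<open>s\<close> (\<open>mean_renewal\<close>).  Here \<open>G u\<close> is the mean of \<open>f\<close> at the sum of a batch of age
  \<open>u\<close> and of independent queue lengths of the fresh network at time \<open>u\<close>, and both \<open>F u\<close> and
  \<open>G u\<close> are \<open>f 0\<close> for negative \<open>u\<close>.

  The itineraries in different batches share only their one-dimensional marginals, so that the fresh
  network need not have the same law as the original one.  Still, for each \<open>t\<close> the law of \<open>N t\<close>
  depends only on the rate, on the law of the batches and on \<open>q\<close>: by the renewal equation the means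
  for two networks with these data differ by at most \<open>2 * (1 - exp (- lam * t)) ^ n\<close> for every \<open>n\<close>
  (\<open>mean_of_lengths_unique\<close>).  Hence \<open>G u\<close> and \<open>F u\<close> are means of \<open>f\<close> at two vectors, the second
  of which has the law of \<open>N u\<close>, that agree unless some customer of the batch of age \<open>u\<close> is still
  present.  Their distance is at most twice the probability of this event.

  A renewal equation with exponential waiting times is an integrated differential equation:
  \<open>F b - F a\<close> is \<open>lam\<close> times the integral of \<open>G - F\<close> over \<open>{a<..b}\<close>
  (\<open>exponential_renewal_increment\<close>).  It remains to see that the probability that something is
  left of a batch of age \<open>u\<close> is integrable in \<open>u\<close>.  By the tail hypothesis, for late \<open>u\<close> it is at
  most the mean of \<open>min 1 (Y * exp (- \<delta> * u))\<close>, where \<open>Y\<close> is the size of a batch, and for a fixed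
  value of \<open>Y\<close> the integral over all \<open>u \<ge> 0\<close> of the expression under the mean is at most
  \<open>(ln (Y + 1) + 1) / \<delta>\<close>.  This is where the logarithmic moment enters.
\<close>

section \<open>Measurability of the queue lengths\<close>

lemma measurable_vec_card:
  fixes P :: "'k::finite \<Rightarrow> 'i::countable \<Rightarrow> 'a \<Rightarrow> bool"
  assumes [measurable]: "\<And>k i. Measurable.pred N (P k i)"
  shows "(\<lambda>x. \<chi> k. card {i. P k i x}) \<in> measurable N (count_space UNIV)"
proof -
  have card_meas[measurable]: "(\<lambda>x. card {i. P k i x}) \<in> measurable N (count_space UNIV)" for k
  proof -
    have "(\<lambda>x. card (to_nat ` {i. P k i x})) \<in> measurable N (count_space UNIV)"
    proof (rule measurable_card)
      fix n :: nat
      have "{x \<in> space N. n \<in> to_nat ` {i. P k i x}} = {x \<in> space N. \<exists>i. n = to_nat i \<and> P k i x}"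
        by auto
      also have "\<dots> \<in> sets N" by measurable
      finally show "{x \<in> space N. n \<in> to_nat ` {i. P k i x}} \<in> sets N" .
    qed
    then show ?thesis by (simp add: card_image)
  qed
  show ?thesis
    unfolding measurable_count_space_eq2_countable
  proof (intro conjI ballI)
    fix v :: "nat ^ 'k"
    have "(\<lambda>x. \<chi> k. card {i. P k i x}) -` {v} \<inter> space N = {x \<in> space N. \<forall>k. card {i. P k i x} = v $ k}"
      by (auto simp: vec_eq_iff)
    also have "\<dots> \<in> sets N" by measurable
    finally show "(\<lambda>x. \<chi> k. card {i. P k i x}) -` {v} \<inter> space N \<in> sets N" .
  qed auto
qed

text \<open>
  The queue lengths caused by one batch \<open>s\<close> whose customers are at the positions \<open>x\<close>.  The
  positions are those of all potential customers, as one function, so that their joint law can be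
  stated independently of the size of the batch.
\<close>

definition census :: "nat ^ 'j \<Rightarrow> ('j \<times> nat \<Rightarrow> 'j option) \<Rightarrow> nat ^ 'j::finite" where
  "census s x = (\<chi> k. card {(j, l). l < s $ j \<and> x (j, l) = Some k})"

lemma measurable_census [measurable (raw)]:
  fixes s :: "'a \<Rightarrow> nat ^ 'j::finite"
  assumes [measurable]: "s \<in> measurable N (count_space UNIV)"
    and [measurable]: "\<And>j l. (\<lambda>\<omega>. x \<omega> (j, l)) \<in> measurable N (count_space UNIV)"
  shows "(\<lambda>\<omega>. census (s \<omega>) (x \<omega>)) \<in> measurable N (count_space UNIV)"
proof -
  have "(\<lambda>\<omega>. \<chi> k. card {p. snd p < s \<omega> $ fst p \<and> x \<omega> (fst p, snd p) = Some k})
      \<in> measurable N (count_space UNIV)"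
    by (intro measurable_vec_card) measurable
  then show ?thesis by (simp add: census_def case_prod_unfold)
qed

lemma census_eq_0:
  assumes "\<And>j l. l < s $ j \<Longrightarrow> x (j, l) = None"
  shows "census s x = 0"
proof -
  have "{(j, l). l < s $ j \<and> x (j, l) = Some k} = {}" for k
    using assms by fastforce
  then show ?thesis by (simp only: census_def vec_eq_iff) simp
qed

text \<open>
  Measurability in time and outcome jointly is needed because the queue lengths are going to be
  evaluated at a random time.  The \<sigma>-algebra \<open>N\<close> is left open: it will be generated by some of
  the sources of randomness, never by \<open>M\<close> itself, as independence of the random time is known only
  relative to the sources.
\<close>

lemma measurable_queue_lengths:
  fixes \<Sigma> :: "nat \<Rightarrow> 'w \<Rightarrow> nat ^ 'j::finite"
  assumes T [measurable]: "\<And>i. T i \<in> borel_measurable N"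
    and \<Sigma> [measurable]: "\<And>i. \<Sigma> i \<in> measurable N (count_space UNIV)"
    and X: "\<And>i j l. (\<lambda>(t, \<omega>). X i j l t \<omega>) \<in>
          measurable (restrict_space borel {0..} \<Otimes>\<^sub>M N) (count_space UNIV)"
  shows "(\<lambda>(t, \<omega>). queue_lengths T \<Sigma> X t \<omega>) \<in>
          measurable (restrict_space borel {0..} \<Otimes>\<^sub>M N) (count_space UNIV)"
proof -
  let ?R = "restrict_space borel {0..} :: real measure"
  have [measurable]: "(\<lambda>p. fst p) \<in> borel_measurable (?R \<Otimes>\<^sub>M N)"
    by (rule measurable_compose[OF measurable_fst measurable_restrict_space1]) simp
  \<comment> \<open>Ages are truncated at \<open>0\<close> because nothing is known about \<open>X\<close> at negative times; where the age is
    negative, the customer is not counted anyway.\<close>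
  have "(\<lambda>p. X i j l (max 0 (fst p - T i (snd p))) (snd p)) \<in> measurable (?R \<Otimes>\<^sub>M N) (count_space UNIV)"
    for i j l
  proof -
    have "(\<lambda>p. (max 0 (fst p - T i (snd p)), snd p)) \<in> measurable (?R \<Otimes>\<^sub>M N) (?R \<Otimes>\<^sub>M N)"
      by (intro measurable_Pair measurable_restrict_space2) auto
    from measurable_compose[OF this X[of i j l]] show ?thesis by simp
  qed
  note this[measurable]
  have "(\<lambda>p. \<chi> k. card {a. T (fst a) (snd p) \<le> fst p \<and> snd (snd a) < \<Sigma> (fst a) (snd p) $ (fst (snd a))
      \<and> X (fst a) (fst (snd a)) (snd (snd a)) (max 0 (fst p - T (fst a) (snd p))) (snd p) = Some k})
      \<in> measurable (?R \<Otimes>\<^sub>M N) (count_space UNIV)"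
    by (intro measurable_vec_card) measurable
  also have "(\<lambda>p. \<chi> k. card {a. T (fst a) (snd p) \<le> fst p \<and> snd (snd a) < \<Sigma> (fst a) (snd p) $ (fst (snd a))
      \<and> X (fst a) (fst (snd a)) (snd (snd a)) (max 0 (fst p - T (fst a) (snd p))) (snd p) = Some k}) = 
     (\<lambda>(t, \<omega>). queue_lengths T \<Sigma> X t \<omega>)"
    by (auto simp: queue_lengths_def fun_eq_iff vec_eq_iff case_prod_unfold intro!: arg_cong[where f=card])
  finally show ?thesis .
qed

definition sources ::
  "'w measure \<Rightarrow> (nat \<Rightarrow> 'w \<Rightarrow> real) \<Rightarrow> (nat \<Rightarrow> 'w \<Rightarrow> nat ^ 'j::finite) \<Rightarrow>
   (nat \<Rightarrow> 'j \<Rightarrow> nat \<Rightarrow> real \<Rightarrow> 'w \<Rightarrow> 'j option) \<Rightarrow> 'j source set \<Rightarrow> 'w measure" where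
  "sources M T \<Sigma> X A = sigma (space M) (\<Union>a\<in>A. sets (source_algebra M T \<Sigma> X a))"

lemma space_source_algebra [simp]: "space (source_algebra M T \<Sigma> X a) = space M"
  by (cases a) (auto simp: history_def)

lemma space_sources [simp]: "space (sources M T \<Sigma> X A) = space M"
  unfolding sources_def
  by (intro space_measure_of) (use sets.sets_into_space[of _ "source_algebra M T \<Sigma> X a" for a] in auto)

lemma sets_sources:
  "sets (sources M T \<Sigma> X A) = sigma_sets (space M) (\<Union>a\<in>A. sets (source_algebra M T \<Sigma> X a))"
  unfolding sources_def
  by (intro sets_measure_of) (use sets.sets_into_space[of _ "source_algebra M T \<Sigma> X a" for a] in auto)

lemma sets_source_algebra_subset:
  assumes "a \<in> A"
  shows "sets (source_algebra M T \<Sigma> X a) \<subseteq> sets (sources M T \<Sigma> X A)"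
  unfolding sets_sources using assms by (auto intro!: sigma_sets.Basic)

lemma measurable_sources:
  assumes "a \<in> A" "f \<in> measurable (source_algebra M T \<Sigma> X a) N"
  shows "f \<in> measurable (sources M T \<Sigma> X A) N"
  using assms sets_source_algebra_subset[OF assms(1), of M T \<Sigma> X] by (auto simp: measurable_def)

lemma measurable_id_sources:
  assumes "a \<in> A"
  shows "(\<lambda>\<omega>. \<omega>) \<in> measurable (sources M T \<Sigma> X A) (source_algebra M T \<Sigma> X a)"
  using assms by (intro measurable_sources) auto

context batch_network
begin

lemma sets_source_algebra_le: "sets (source_algebra M T \<Sigma> X a) \<subseteq> sets M"
  using independent by (auto simp: indep_sets_def)

lemma sets_sources_le: "sets (sources M T \<Sigma> X A) \<subseteq> sets M"
  unfolding sets_sources using sets_source_algebra_le by (intro sets.sigma_sets_subset) auto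

lemma measurable_from_sources:
  "f \<in> measurable (sources M T \<Sigma> X A) N \<Longrightarrow> f \<in> measurable M N"
  using sets_sources_le by (auto simp: measurable_def)

lemma measurable_T_sources:
  assumes "Arrivals \<in> A"
  shows "T i \<in> borel_measurable (sources M T \<Sigma> X A)"
proof (rule measurable_sources[OF assms])
  have "(\<lambda>\<omega> i. T i \<omega>) \<in> measurable (vimage_algebra (space M) (\<lambda>\<omega> i. T i \<omega>) (\<Pi>\<^sub>M i\<in>UNIV. borel))
       (\<Pi>\<^sub>M i\<in>UNIV. borel)"
    by (rule measurable_vimage_algebra1) (auto simp: space_PiM)
  from measurable_compose[OF this measurable_component_singleton[of i]]
  show "T i \<in> borel_measurable (source_algebra M T \<Sigma> X Arrivals)" by simp
qed

lemma measurable_\<Sigma>_sources: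
  assumes "Batch i \<in> A"
  shows "\<Sigma> i \<in> measurable (sources M T \<Sigma> X A) (count_space UNIV)"
  by (rule measurable_sources[OF assms]) (auto intro!: measurable_vimage_algebra1)

lemma measurable_X_sources:
  assumes "Customer i j l \<in> A"
  shows "(\<lambda>(t, \<omega>). X i j l t \<omega>) \<in>
     measurable (restrict_space borel {0..} \<Otimes>\<^sub>M sources M T \<Sigma> X A) (count_space UNIV)"
proof -
  have "(\<lambda>p. (fst p, snd p)) \<in> measurable (restrict_space borel {0..} \<Otimes>\<^sub>M sources M T \<Sigma> X A)
      (restrict_space borel {0..} \<Otimes>\<^sub>M history M (X i j l))"
    using measurable_id_sources[OF assms, of M T \<Sigma> X]
    by (intro measurable_Pair measurable_fst measurable_compose[OF measurable_snd]) auto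
  from measurable_compose[OF this X_measurable[of i j l]] show ?thesis
    by (simp add: case_prod_unfold)
qed

lemma measurable_X_at_history:
  assumes "t \<ge> 0"
  shows "X i j l t \<in> measurable (source_algebra M T \<Sigma> X (Customer i j l)) (count_space UNIV)"
proof -
  have "(\<lambda>\<omega>. \<lambda>t\<in>{0..}. X i j l t \<omega>) \<in> measurable (history M (X i j l)) (\<Pi>\<^sub>M t\<in>{0..}. count_space UNIV)"
    unfolding history_def by (rule measurable_vimage_algebra1) (auto simp: space_PiM)
  from measurable_compose[OF this measurable_component_singleton[of t]] assms
  show ?thesis by simp
qed

lemma measurable_queue_lengths_sources:
  "(\<lambda>(t, \<omega>). queue_lengths T \<Sigma> X t \<omega>) \<in>
     measurable (restrict_space borel {0..} \<Otimes>\<^sub>M sources M T \<Sigma> X UNIV) (count_space UNIV)"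
  by (intro measurable_queue_lengths measurable_T_sources measurable_\<Sigma>_sources measurable_X_sources) simp_all

lemma measurable_queue_lengths_at:
  assumes "t \<ge> 0"
  shows "queue_lengths T \<Sigma> X t \<in> measurable (sources M T \<Sigma> X UNIV) (count_space UNIV)"
proof -
  have "(\<lambda>\<omega>. (t, \<omega>)) \<in> measurable (sources M T \<Sigma> X UNIV)
      (restrict_space borel {0..} \<Otimes>\<^sub>M sources M T \<Sigma> X UNIV)"
    using assms by (intro measurable_Pair measurable_const) (auto simp: space_restrict_space)
  from measurable_compose[OF this measurable_queue_lengths_sources] show ?thesis by simp
qed

lemma measurable_census_sources:
  assumes A: "Batch i \<in> A" "\<And>j l. Customer i j l \<in> A"
  shows "(\<lambda>(t, \<omega>). census (\<Sigma> i \<omega>) (\<lambda>(j, l). X i j l t \<omega>)) \<in>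
     measurable (restrict_space borel {0..} \<Otimes>\<^sub>M sources M T \<Sigma> X A) (count_space UNIV)"
proof -
  note [measurable] = measurable_\<Sigma>_sources[OF A(1)] 
  have [measurable]: "(\<lambda>p. X i j l (fst p) (snd p)) \<in> measurable (restrict_space borel {0..} \<Otimes>\<^sub>M sources M T \<Sigma> X A) (count_space UNIV)" for j l
    using measurable_X_sources[OF A(2), of j l] by (simp add: case_prod_unfold)
  have "(\<lambda>p. census (\<Sigma> i (snd p)) (\<lambda>(j, l). X i j l (fst p) (snd p))) \<in>
     measurable (restrict_space borel {0..} \<Otimes>\<^sub>M sources M T \<Sigma> X A) (count_space UNIV)"
    by (rule measurable_census) simp_all
  then show ?thesis by (simp add: case_prod_unfold)
qed

end

section \<open>Independence and the network seen from its first arrival\<close>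

lemma (in prob_space) indep_sets_reindex:
  assumes "inj f" "indep_sets F UNIV"
  shows "indep_sets (\<lambda>i. F (f i)) UNIV"
proof (rule indep_setsI)
  show "F (f i) \<subseteq> events" for i using assms(2) by (auto simp: indep_sets_def)
next
  fix A J assume J: "J \<noteq> {}" "finite J" "\<forall>j\<in>J. A j \<in> F (f j)"
  have inv: "the_inv f (f i) = i" for i using assms(1) by (simp add: the_inv_f_f)
  have "prob (\<Inter>k\<in>f ` J. A (the_inv f k)) = (\<Prod>k\<in>f ` J. prob (A (the_inv f k)))"
    using J by (intro indep_setsD[OF assms(2)]) (auto simp: inv)
  then show "prob (\<Inter>j\<in>J. A j) = (\<Prod>j\<in>J. prob (A j))"
    using assms(1) by (simp add: inv prod.reindex inj_on_subset)
qed

text \<open>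
  A random variable \<open>Y\<close> that is independent of a \<sigma>-algebra \<open>G\<close> may be integrated out separately
  wherever it is substituted into a jointly measurable function: the map from \<open>\<omega>\<close> to \<open>(Y \<omega>, \<omega>)\<close>,
  with the second component read in \<open>G\<close>, has a product law.
\<close>

lemma (in prob_space) expectation_indep:
  fixes H :: "'b \<Rightarrow> 'a \<Rightarrow> real"
  assumes F: "space F = space M" "sets F \<subseteq> events"
    and G: "space G = space M" "sets G \<subseteq> events"
    and ind: "indep_set (sets F) (sets G)"
    and Y: "Y \<in> measurable F N"
    and H: "(\<lambda>(y, \<omega>). H y \<omega>) \<in> borel_measurable (N \<Otimes>\<^sub>M G)"
    and bounded: "\<And>y \<omega>. \<bar>H y \<omega>\<bar> \<le> c"
  shows "expectation (\<lambda>\<omega>. H (Y \<omega>) \<omega>) = (\<integral>y. expectation (H y) \<partial>distr M N Y)"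
proof -
  have Y_M [measurable]: "Y \<in> measurable M N" and id_M [measurable]: "(\<lambda>\<omega>. \<omega>) \<in> measurable M G"
    using Y F G by (auto simp: measurable_def)
  interpret Y: prob_space "distr M N Y" by (rule prob_space_distr) fact
  interpret G: prob_space "distr M G (\<lambda>\<omega>. \<omega>)" by (rule prob_space_distr) fact
  have distr_eq: "distr M N Y \<Otimes>\<^sub>M distr M G (\<lambda>\<omega>. \<omega>) = distr M (N \<Otimes>\<^sub>M G) (\<lambda>\<omega>. (Y \<omega>, \<omega>))"
  proof (rule pair_measure_eqI)
    show "sigma_finite_measure (distr M N Y)" "sigma_finite_measure (distr M G (\<lambda>\<omega>. \<omega>))" ..
    fix A B assume A: "A \<in> sets (distr M N Y)" and B: "B \<in> sets (distr M G (\<lambda>\<omega>. \<omega>))"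
    then have [measurable]: "A \<in> sets N" "B \<in> sets G" by auto
    have YA: "Y -` A \<inter> space M \<in> sets F" using measurable_sets[OF Y] A F(1) by auto
    have "B \<subseteq> space M" using B sets.sets_into_space[of B G] G(1) by auto
    then have "(\<lambda>\<omega>. (Y \<omega>, \<omega>)) -` (A \<times> B) \<inter> space M = (Y -` A \<inter> space M) \<inter> B" "B \<inter> space M = B" by auto
    then show "emeasure (distr M N Y) A * emeasure (distr M G (\<lambda>\<omega>. \<omega>)) B
        = emeasure (distr M (N \<Otimes>\<^sub>M G) (\<lambda>\<omega>. (Y \<omega>, \<omega>))) (A \<times> B)"
      using indep_setD[OF ind YA, of B] B
      by (simp add: emeasure_distr emeasure_eq_measure ennreal_mult)
  qed simp
  interpret P: pair_prob_space "distr M N Y" "distr M G (\<lambda>\<omega>. \<omega>)" ..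
  have int: "integrable (distr M N Y \<Otimes>\<^sub>M distr M G (\<lambda>\<omega>. \<omega>)) (\<lambda>(y, \<omega>). H y \<omega>)"
  proof (rule P.integrable_const_bound[where B=c])
    show "(\<lambda>(y, \<omega>). H y \<omega>) \<in> borel_measurable (distr M N Y \<Otimes>\<^sub>M distr M G (\<lambda>\<omega>. \<omega>))"
      using H by (simp cong: measurable_cong_sets)
  qed (use bounded in auto)
  have "expectation (\<lambda>\<omega>. H (Y \<omega>) \<omega>) = (\<integral>p. (case p of (y, \<omega>) \<Rightarrow> H y \<omega>) \<partial>distr M (N \<Otimes>\<^sub>M G) (\<lambda>\<omega>. (Y \<omega>, \<omega>)))"
    using H by (subst integral_distr) auto
  also have "\<dots> = (\<integral>y. (\<integral>\<omega>. H y \<omega> \<partial>distr M G (\<lambda>\<omega>. \<omega>)) \<partial>distr M N Y)"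
    unfolding distr_eq[symmetric] using P.integral_fst'[OF int] by simp
  also have "\<dots> = (\<integral>y. expectation (H y) \<partial>distr M N Y)"
  proof (rule Bochner_Integration.integral_cong[OF refl])
    fix y assume "y \<in> space (distr M N Y)"
    then have "(\<lambda>\<omega>. H y \<omega>) \<in> borel_measurable G"
      using measurable_compose[OF measurable_Pair1' H] by auto
    then show "(\<integral>\<omega>. H y \<omega> \<partial>distr M G (\<lambda>\<omega>. \<omega>)) = expectation (H y)"
      by (subst integral_distr) auto
  qed
  finally show ?thesis .
qed

definition tail_arrivals :: "(nat \<Rightarrow> 'w \<Rightarrow> real) \<Rightarrow> nat \<Rightarrow> 'w \<Rightarrow> real" where
  "tail_arrivals T i \<omega> = T (Suc i) \<omega> - T 0 \<omega>"

lemma interarrival_tail_arrivals: "interarrival (tail_arrivals T) i = interarrival T (Suc i)"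
  by (cases i) (auto simp: tail_arrivals_def fun_eq_iff)

lemma arrival_eq_sum_interarrival: "T i \<omega> = (\<Sum>k\<le>i. interarrival T k \<omega>)"
  by (induction i) auto

text \<open>
  Dropping the first batch renumbers the batches by \<open>Suc\<close>.  With \<open>g\<close> the identity, the arrival
  epochs are shifted but all batches are kept; that auxiliary network serves to express that the
  first arrival is independent of all batches, the first one included.
\<close>

fun renumber :: "(nat \<Rightarrow> nat) \<Rightarrow> 'j source \<Rightarrow> 'j source" where
  "renumber g Arrivals = Arrivals"
| "renumber g (Batch i) = Batch (g i)"
| "renumber g (Customer i j l) = Customer (g i) j l"

lemma inj_renumber: "inj g \<Longrightarrow> inj (renumber g)"
proof (rule injI)
  fix a b :: "'j source" assume "inj g" "renumber g a = renumber g b"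
  then show "a = b" by (cases a; cases b) (auto dest: injD)
qed

lemma tail_arrivals_measurable_arrivals:
  "(\<lambda>\<omega> i. tail_arrivals T i \<omega>) \<in> measurable (vimage_algebra (space M) (\<lambda>\<omega> i. T i \<omega>) (\<Pi>\<^sub>M i\<in>UNIV. borel))
     (\<Pi>\<^sub>M i\<in>UNIV. borel)"
proof -
  have *: "(\<lambda>\<omega> i. T i \<omega>) \<in> measurable (vimage_algebra (space M) (\<lambda>\<omega> i. T i \<omega>) (\<Pi>\<^sub>M i\<in>UNIV. borel))
       (\<Pi>\<^sub>M i\<in>UNIV. borel)"
    by (rule measurable_vimage_algebra1) (auto simp: space_PiM)
  have [measurable]: "T i \<in> borel_measurable (vimage_algebra (space M) (\<lambda>\<omega> i. T i \<omega>) (\<Pi>\<^sub>M i\<in>UNIV. borel))" for i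
    using measurable_compose[OF * measurable_component_singleton[of i]] by simp
  show ?thesis
    by (rule measurable_PiM_single') (auto simp: tail_arrivals_def)
qed

lemma sets_source_algebra_tail:
  "sets (source_algebra M (tail_arrivals T) (\<lambda>i. \<Sigma> (g i)) (\<lambda>i. X (g i)) a)
     \<subseteq> sets (source_algebra M T \<Sigma> X (renumber g a))"
proof (cases a)
  case Arrivals
  show ?thesis
    unfolding Arrivals source_algebra.simps renumber.simps
    by (subst sets_vimage_algebra2)
      (use measurable_sets[OF tail_arrivals_measurable_arrivals[of T M]] in \<open>auto simp: space_PiM\<close>)
qed auto

context batch_network
begin

lemma tail_network:
  assumes "inj g"
  shows "batch_network M lam (tail_arrivals T) (\<lambda>i. \<Sigma> (g i)) S (\<lambda>i. X (g i)) q"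
proof
  show "poisson_points M lam (tail_arrivals T)"
    using arrivals
    unfolding poisson_points_def indep_vars_def2 interarrival_tail_arrivals
    by (auto intro: indep_sets_reindex[of Suc, simplified])
  have "indep_sets (\<lambda>a. sets (source_algebra M T \<Sigma> X (renumber g a))) UNIV"
    by (rule indep_sets_reindex[OF inj_renumber[OF assms] independent])
  then show "indep_sets (\<lambda>a. sets (source_algebra M (tail_arrivals T) (\<lambda>i. \<Sigma> (g i)) (\<lambda>i. X (g i)) a)) UNIV"
    by (rule indep_sets_mono_sets) (rule sets_source_algebra_tail)
qed (fact lam_pos S_random \<Sigma>_random \<Sigma>_distr X_random X_measurable X_prob q_measurable no_return)+

lemma indep_sources:
  assumes "A \<inter> B = {}"
  shows "indep_set (sets (sources M T \<Sigma> X A)) (sets (sources M T \<Sigma> X B))"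
proof -
  let ?I = "case_bool A B"
  have "indep_sets (\<lambda>b. sigma_sets (space M) (\<Union>a\<in>?I b. sets (source_algebra M T \<Sigma> X a))) UNIV"
  proof (rule indep_sets_collect_sigma)
    show "indep_sets (\<lambda>a. sets (source_algebra M T \<Sigma> X a)) (\<Union>b\<in>UNIV. ?I b)"
      using independent by (rule indep_sets_mono_index[rotated]) auto
    show "disjoint_family_on ?I UNIV"
      using assms by (auto simp: disjoint_family_on_def split: bool.splits)
  qed (auto simp: Int_stable_def)
  then show ?thesis
    unfolding indep_set_def sets_sources
    by (rule indep_sets_mono_sets) (auto split: bool.split)
qed

text \<open>
  The first arrival epoch is the first interarrival time, and the later epochs, measured from it, are
  partial sums of the other interarrival times.
\<close>

lemma indep_first_arrival_tail:
  "indep_set (sets (vimage_algebra (space M) (T 0) borel))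
     (sets (vimage_algebra (space M) (\<lambda>\<omega> i. tail_arrivals T i \<omega>) (\<Pi>\<^sub>M i\<in>UNIV. borel)))"
proof -
  let ?I = "interarrival T"
  let ?r0 = "\<lambda>\<omega>. \<lambda>k\<in>{0}. ?I k \<omega>" and ?r1 = "\<lambda>\<omega>. \<lambda>k\<in>{1..}. ?I k \<omega>"
  have iv: "indep_vars (\<lambda>_. borel) ?I UNIV"
    using arrivals by (simp add: poisson_points_def)
  have "indep_var (\<Pi>\<^sub>M k\<in>{0}. borel) ?r0 (\<Pi>\<^sub>M k\<in>{1..}. borel) ?r1"
    by (rule indep_var_restrict[OF iv]) auto
  then have "indep_var (\<Pi>\<^sub>M i\<in>UNIV. borel) ((\<lambda>f i. f 0) \<circ> ?r0) (\<Pi>\<^sub>M i\<in>UNIV. borel) ((\<lambda>f i. \<Sum>k\<in>{1..Suc i}. f k) \<circ> ?r1)"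
    by (rule indep_var_compose) (auto intro!: measurable_PiM_single' borel_measurable_sum measurable_component_singleton)
  moreover have "(\<lambda>f (i::nat). f 0) \<circ> ?r0 = (\<lambda>\<omega> i. T 0 \<omega>)" by (auto simp: fun_eq_iff)
  moreover have "(\<lambda>f i. \<Sum>k\<in>{1..Suc i}. f k) \<circ> ?r1 = (\<lambda>\<omega> i. tail_arrivals T i \<omega>)"
  proof (intro ext)
    fix \<omega> i
    have "T (Suc i) \<omega> = (\<Sum>k\<in>insert 0 {1..Suc i}. ?I k \<omega>)"
      by (subst arrival_eq_sum_interarrival) (rule sum.cong, auto)
    also have "\<dots> = T 0 \<omega> + (\<Sum>k\<in>{1..Suc i}. ?I k \<omega>)"
      by (subst sum.insert) auto
    finally have "tail_arrivals T i \<omega> = (\<Sum>k\<in>{1..Suc i}. ?I k \<omega>)"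
      unfolding tail_arrivals_def by linarith
    moreover have "((\<lambda>f i. \<Sum>k\<in>{1..Suc i}. f k) \<circ> ?r1) \<omega> i = (\<Sum>k\<in>{1..Suc i}. ?I k \<omega>)"
      unfolding comp_def by (rule sum.cong) auto
    ultimately show "((\<lambda>f i. \<Sum>k\<in>{1..Suc i}. f k) \<circ> ?r1) \<omega> i = tail_arrivals T i \<omega>" by (rule trans[OF _ sym, rotated])
  qed
  ultimately have iv2: "indep_var (\<Pi>\<^sub>M i\<in>UNIV. borel) (\<lambda>\<omega> i. T 0 \<omega>)
      (\<Pi>\<^sub>M i\<in>UNIV. borel) (\<lambda>\<omega> i. tail_arrivals T i \<omega>)" by (simp only:)
  have "T 0 -` A \<inter> space M \<in> sigma_sets (space M)
      {(\<lambda>\<omega> (i::nat). T 0 \<omega>) -` B \<inter> space M |B. B \<in> sets (\<Pi>\<^sub>M i\<in>UNIV. borel)}" if [measurable]: "A \<in> sets borel" for A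
  proof (rule sigma_sets.Basic, intro CollectI exI conjI)
    show "{f \<in> space (\<Pi>\<^sub>M i\<in>UNIV. borel). f (0::nat) \<in> A} \<in> sets (\<Pi>\<^sub>M i\<in>UNIV. borel)" by measurable
  qed (auto simp: space_PiM)
  then have T0: "sets (vimage_algebra (space M) (T 0) borel) \<subseteq> sigma_sets (space M)
      {(\<lambda>\<omega> (i::nat). T 0 \<omega>) -` B \<inter> space M |B. B \<in> sets (\<Pi>\<^sub>M i\<in>UNIV. borel)}"
    by (subst sets_vimage_algebra2) auto
  have T': "sets (vimage_algebra (space M) (\<lambda>\<omega> i. tail_arrivals T i \<omega>) (\<Pi>\<^sub>M i\<in>UNIV. borel)) \<subseteq> sigma_sets (space M)
      {(\<lambda>\<omega> i. tail_arrivals T i \<omega>) -` B \<inter> space M |B. B \<in> sets (\<Pi>\<^sub>M i\<in>UNIV. borel)}"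
    by (subst sets_vimage_algebra2) (auto simp: space_PiM)
  have "indep_sets (case_bool
       (sigma_sets (space M) {(\<lambda>\<omega> (i::nat). T 0 \<omega>) -` B \<inter> space M |B. B \<in> sets (\<Pi>\<^sub>M i\<in>UNIV. borel)})
       (sigma_sets (space M) {(\<lambda>\<omega> i. tail_arrivals T i \<omega>) -` B \<inter> space M |B. B \<in> sets (\<Pi>\<^sub>M i\<in>UNIV. borel)})) UNIV"
    using iv2 unfolding indep_var_eq indep_set_def by blast
  then show ?thesis
    unfolding indep_set_def
  proof (rule indep_sets_mono_sets)
    fix b show "case_bool (sets (vimage_algebra (space M) (T 0) borel))
         (sets (vimage_algebra (space M) (\<lambda>\<omega> i. tail_arrivals T i \<omega>) (\<Pi>\<^sub>M i\<in>UNIV. borel))) b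
      \<subseteq> case_bool
       (sigma_sets (space M) {(\<lambda>\<omega> (i::nat). T 0 \<omega>) -` B \<inter> space M |B. B \<in> sets (\<Pi>\<^sub>M i\<in>UNIV. borel)})
       (sigma_sets (space M) {(\<lambda>\<omega> i. tail_arrivals T i \<omega>) -` B \<inter> space M |B. B \<in> sets (\<Pi>\<^sub>M i\<in>UNIV. borel)}) b"
      using T0 T' by (cases b) simp_all
  qed
qed

text \<open>
  The source of all arrival epochs is split into two independent parts, the first epoch and the rest.
  A finite family of events from the refined sources has its at most two arrival events combined into
  one event of the original source, so that the product formula for the refined family follows from
  the one for the original sources and the splitting of the arrivals.
\<close>

lemma indep_first_arrival:
  "indep_set (sets (vimage_algebra (space M) (T 0) borel)) (sets (sources M (tail_arrivals T) \<Sigma> X UNIV))"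
proof -
  let ?T0 = "vimage_algebra (space M) (T 0) borel"
  let ?S = "\<lambda>a. source_algebra M (tail_arrivals T) \<Sigma> X a"
  define F where "F = case_option (sets ?T0) (\<lambda>a. sets (?S a))"
  have T0: "sets ?T0 \<subseteq> sets (source_algebra M T \<Sigma> X Arrivals)"
  proof -
    have "T 0 \<in> borel_measurable (sources M T \<Sigma> X {Arrivals})"
      by (rule measurable_T_sources) simp
    moreover have "sets (sources M T \<Sigma> X {Arrivals}) = sets (source_algebra M T \<Sigma> X Arrivals)"
      unfolding sets_sources using sets.sigma_sets_eq[of "source_algebra M T \<Sigma> X Arrivals"]
      by (simp del: source_algebra.simps)
    ultimately show ?thesis
      by (subst sets_vimage_algebra2) (auto simp del: source_algebra.simps dest: measurable_sets)
  qed
  have S: "sets (?S a) \<subseteq> sets (source_algebra M T \<Sigma> X a)" for a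
    using sets_source_algebra_tail[of M T \<Sigma> "\<lambda>i. i" X a] by (cases a) auto
  have F_top: "space M \<in> F j" for j
    using sets.top[of "?T0"] sets.top[of "?S a" for a]
    by (auto simp: F_def split: option.split simp del: source_algebra.simps sets.top)
  have "indep_sets F UNIV"
  proof (rule indep_setsI)
    show F_events: "F j \<subseteq> events" for j
    proof (cases j)
      case None
      then show ?thesis using subset_trans[OF T0 sets_source_algebra_le] by (simp add: F_def)
    next
      case (Some a)
      then show ?thesis using subset_trans[OF S sets_source_algebra_le] by (simp add: F_def)
    qed
    fix A J assume J: "J \<noteq> {}" "finite J" "\<forall>j\<in>J. A j \<in> F j"
    define A' where "A' j = (if j \<in> J then A j else space M)" for j
    have A': "A' j \<in> F j" for j using J F_top by (simp add: A'_def)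
    (* None stands for the first arrival and Some a for the other sources.  D regroups the events by
       the original sources. *)
    define K where "K = insert Arrivals (Some -` J)"
    have "finite K"
      using J(2) by (simp add: K_def finite_vimageI)
    define D where "D a = (if a = Arrivals then A' None \<inter> A' (Some Arrivals) else A' (Some a))" for a
    have D: "D a \<in> sets (source_algebra M T \<Sigma> X a)" for a
    proof (cases "a = Arrivals")
      case True
      have "A' None \<in> sets (source_algebra M T \<Sigma> X a)" "A' (Some a) \<in> sets (source_algebra M T \<Sigma> X a)"
        using A'[of None] A'[of "Some a"] T0 S[of a] unfolding True F_def option.case by blast+
      then show ?thesis using True by (simp add: D_def sets.Int del: source_algebra.simps)
    next
      case False
      then show ?thesis
        using A'[of "Some a"] S[of a] unfolding D_def F_def option.case by auto
    qed
    have sub: "A j \<subseteq> space M" if "j \<in> J" for j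
      using that J(3) F_events sets.sets_into_space by blast
    have "(\<Inter>j\<in>J. A j) = (\<Inter>a\<in>K. D a)"
    proof
      show "(\<Inter>j\<in>J. A j) \<subseteq> (\<Inter>a\<in>K. D a)"
      proof (rule INT_greatest)
        fix a
        have "(\<Inter>j\<in>J. A j) \<subseteq> A' j" for j
          using J(1) sub by (cases "j \<in> J") (auto simp: A'_def)
        then show "(\<Inter>j\<in>J. A j) \<subseteq> D a" by (simp add: D_def)
      qed
      show "(\<Inter>a\<in>K. D a) \<subseteq> (\<Inter>j\<in>J. A j)"
      proof (rule INT_greatest)
        fix j assume "j \<in> J"
        then show "(\<Inter>a\<in>K. D a) \<subseteq> A j"
          by (cases j) (auto simp: D_def K_def A'_def split: if_splits)
      qed
    qed
    then have "prob (\<Inter>j\<in>J. A j) = (\<Prod>a\<in>K. prob (D a))"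
      using indep_setsD[OF independent, of K D] D \<open>finite K\<close> by (simp add: K_def)
    also have "\<dots> = prob (D Arrivals) * (\<Prod>a\<in>K - {Arrivals}. prob (D a))"
      by (rule prod.remove) (use \<open>finite K\<close> in \<open>auto simp: K_def\<close>)
    also have "prob (D Arrivals) = prob (A' None) * prob (A' (Some Arrivals))"
      using indep_setD[OF indep_first_arrival_tail] A'[of None] A'[of "Some Arrivals"]
      by (simp add: D_def F_def)
    also have "(\<Prod>a\<in>K - {Arrivals}. prob (D a)) = (\<Prod>a\<in>K - {Arrivals}. prob (A' (Some a)))"
      by (intro prod.cong) (auto simp: D_def)
    also have "prob (A' None) * prob (A' (Some Arrivals)) * \<dots> = prob (A' None) * (\<Prod>a\<in>K. prob (A' (Some a)))"
      by (subst prod.remove[of K Arrivals]) (use \<open>finite K\<close> in \<open>auto simp: K_def\<close>)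
    also have "\<dots> = (\<Prod>j\<in>insert None (Some ` K). prob (A' j))"
      using \<open>finite K\<close> by (subst prod.insert) (auto simp: prod.reindex)
    also have "\<dots> = (\<Prod>j\<in>J. prob (A' j))"
    proof (rule prod.mono_neutral_right)
      show "J \<subseteq> insert None (Some ` K)"
      proof
        fix j assume "j \<in> J" then show "j \<in> insert None (Some ` K)" by (cases j) (auto simp: K_def)
      qed
    qed (use \<open>finite K\<close> in \<open>auto simp: A'_def prob_space\<close>)
    also have "\<dots> = (\<Prod>j\<in>J. prob (A j))" by (simp add: A'_def)
    finally show "prob (\<Inter>j\<in>J. A j) = (\<Prod>j\<in>J. prob (A j))" .
  qed
  then have "indep_sets (\<lambda>b. sigma_sets (space M) (\<Union>j\<in>case_bool {None} (range Some) b. F j)) UNIV"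
  proof (intro indep_sets_collect_sigma)
    show "Int_stable (F j)" for j by (cases j) (auto simp: F_def Int_stable_def)
  qed (auto simp: disjoint_family_on_def split: bool.splits elim: indep_sets_mono_index[rotated])
  then show ?thesis
    unfolding indep_set_def
  proof (rule indep_sets_mono_sets)
    fix b
    have "sets ?T0 \<subseteq> sigma_sets (space M) (\<Union>j\<in>{None}. F j)"
      by (auto simp: F_def intro: sigma_sets.Basic)
    moreover have "sets (sources M (tail_arrivals T) \<Sigma> X UNIV) = sigma_sets (space M) (\<Union>j\<in>range Some. F j)"
      by (simp add: sets_sources F_def)
    ultimately show "case_bool (sets ?T0) (sets (sources M (tail_arrivals T) \<Sigma> X UNIV)) b
        \<subseteq> sigma_sets (space M) (\<Union>j\<in>case_bool {None} (range Some) b. F j)"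
      by (cases b) simp_all
  qed
qed

lemma sets_sources_tail:
  "sets (sources M (tail_arrivals T) (\<lambda>i. \<Sigma> (g i)) (\<lambda>i. X (g i)) A) \<subseteq> sets (sources M T \<Sigma> X (renumber g ` A))"
proof -
  have "(\<Union>a\<in>A. sets (source_algebra M (tail_arrivals T) (\<lambda>i. \<Sigma> (g i)) (\<lambda>i. X (g i)) a))
    \<subseteq> (\<Union>a\<in>renumber g ` A. sets (source_algebra M T \<Sigma> X a))"
    using sets_source_algebra_tail[of M T \<Sigma> g X] by (auto simp del: source_algebra.simps)
  then show ?thesis unfolding sets_sources by (rule sigma_sets_mono')
qed

end

section \<open>The renewal equation\<close>

lemma (in prob_space) measurable_expectation_section:
  fixes H :: "'b \<Rightarrow> 'a \<Rightarrow> real"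
  assumes G: "space G = space M" "sets G \<subseteq> events"
    and H: "(\<lambda>(y, \<omega>). H y \<omega>) \<in> borel_measurable (N \<Otimes>\<^sub>M G)"
  shows "(\<lambda>y. expectation (H y)) \<in> borel_measurable N"
proof -
  have "(\<lambda>\<omega>. \<omega>) \<in> measurable M G" using G by (auto simp: measurable_def)
  then have "(\<lambda>p. (fst p, snd p)) \<in> measurable (N \<Otimes>\<^sub>M M) (N \<Otimes>\<^sub>M G)"
    by (intro measurable_Pair measurable_fst measurable_compose[OF measurable_snd])
  from measurable_compose[OF this H] have "(\<lambda>(y, \<omega>). H y \<omega>) \<in> borel_measurable (N \<Otimes>\<^sub>M M)"
    by (simp add: case_prod_unfold)
  then show ?thesis by (rule borel_measurable_lebesgue_integral)
qed

lemma (in prob_space) abs_expectation_le: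
  fixes f :: "'a \<Rightarrow> real"
  assumes "\<And>\<omega>. \<bar>f \<omega>\<bar> \<le> c"
  shows "\<bar>expectation f\<bar> \<le> c"
proof (cases "integrable M f")
  case True
  then have "\<bar>expectation f\<bar> \<le> expectation (\<lambda>\<omega>. \<bar>f \<omega>\<bar>)" by (intro integral_abs_bound)
  also have "\<dots> \<le> c" using True assms by (intro integral_le_const) auto
  finally show ?thesis .
next
  case False
  have "0 \<le> c" using assms[of undefined] by linarith
  then show ?thesis using False by (simp add: not_integrable_integral_eq)
qed

lemma measurable_countable_binary:
  fixes g :: "'a \<Rightarrow> 'b::countable" and h :: "'a \<Rightarrow> 'c::countable"
  assumes "g \<in> measurable N (count_space UNIV)" "h \<in> measurable N (count_space UNIV)"
    and "\<And>b c. F b c \<in> space K"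
  shows "(\<lambda>x. F (g x) (h x)) \<in> measurable N K"
proof (rule measurable_compose_countable[of "\<lambda>b x. F b (h x)", OF _ assms(1)])
  have "F b \<in> measurable (count_space UNIV) K" for b using assms(3) by simp
  from measurable_compose[OF assms(2) this] show "(\<lambda>x. F b (h x)) \<in> measurable N K" for b .
qed

text \<open>
  Interarrival times that are nonnegative and not all bounded by \<open>t\<close> ensure that only finitely many
  batches have arrived by time \<open>t\<close>; without finiteness the cardinalities could not be added.
\<close>

lemma queue_lengths_first_arrival:
  fixes \<Sigma> :: "nat \<Rightarrow> 'w \<Rightarrow> nat ^ 'j::finite"
  assumes nonneg: "\<And>i. 0 \<le> interarrival T i \<omega>"
    and large: "\<exists>i. t < interarrival T i \<omega>"
  shows "queue_lengths T \<Sigma> X t \<omega> =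
    (if T 0 \<omega> \<le> t
     then census (\<Sigma> 0 \<omega>) (\<lambda>(j, l). X 0 j l (t - T 0 \<omega>) \<omega>)
        + queue_lengths (tail_arrivals T) (\<lambda>i. \<Sigma> (Suc i)) (\<lambda>i. X (Suc i)) (t - T 0 \<omega>) \<omega>
     else 0)"
proof -
  let ?Q = "\<lambda>k. {(i, j, l). T i \<omega> \<le> t \<and> l < \<Sigma> i \<omega> $ j \<and> X i j l (t - T i \<omega>) \<omega> = Some k}"
  have mono: "T i \<omega> \<le> T j \<omega>" if "i \<le> j" for i j
    using that
  proof (rule lift_Suc_mono_le[rotated])
    show "T k \<omega> \<le> T (Suc k) \<omega>" for k using nonneg[of "Suc k"] by simp
  qed
  obtain m where m: "t < interarrival T m \<omega>" using large by blast
  have "interarrival T m \<omega> \<le> T m \<omega>"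
    using mono[of 0 "m - 1"] nonneg[of 0] by (cases m) auto
  then have late: "t < T i \<omega>" if "m \<le> i" for i using mono[OF that] m by linarith
  have "finite (?Q k)" for k
  proof (rule finite_subset)
    show "?Q k \<subseteq> (SIGMA i:{..m}. SIGMA j:UNIV. {..<\<Sigma> i \<omega> $ j})"
    proof
      fix x assume x: "x \<in> ?Q k"
      obtain i j l where ijl: "x = (i, j, l)" by (cases x)
      have "i \<le> m" using x ijl late[of i] by force
      with x ijl show "x \<in> (SIGMA i:{..m}. SIGMA j:UNIV. {..<\<Sigma> i \<omega> $ j})" by simp
    qed
  qed auto
  note fin = this
  show ?thesis
  proof (cases "T 0 \<omega> \<le> t")
    case False
    then have "\<not> T i \<omega> \<le> t" for i using mono[of 0 i] by simp
    then have "?Q k = {}" for k by simp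
    then show ?thesis using False by (simp only: queue_lengths_def vec_eq_iff) simp
  next
    case True
    let ?u = "t - T 0 \<omega>"
    let ?B = "\<lambda>k. {(j, l). l < \<Sigma> 0 \<omega> $ j \<and> X 0 j l ?u \<omega> = Some k}"
    let ?R = "\<lambda>k. {(i, j, l). tail_arrivals T i \<omega> \<le> ?u \<and> l < \<Sigma> (Suc i) \<omega> $ j
        \<and> X (Suc i) j l (?u - tail_arrivals T i \<omega>) \<omega> = Some k}"
    have split: "?Q k = Pair 0 ` ?B k \<union> (\<lambda>(i, p). (Suc i, p)) ` ?R k" for k
    proof (intro set_eqI iffI)
      fix x assume x: "x \<in> ?Q k"
      obtain i j l where ijl: "x = (i, j, l)" by (cases x)
      show "x \<in> Pair 0 ` ?B k \<union> (\<lambda>(i, p). (Suc i, p)) ` ?R k"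
      proof (cases i)
        case 0
        then have "(j, l) \<in> ?B k" using x ijl by simp
        then show ?thesis using ijl 0 by blast
      next
        case (Suc i')
        then have "(i', j, l) \<in> ?R k" using x ijl by (simp add: tail_arrivals_def)
        then have "(\<lambda>(i, p). (Suc i, p)) (i', j, l) \<in> (\<lambda>(i, p). (Suc i, p)) ` ?R k" by (rule imageI)
        then show ?thesis using ijl Suc by simp
      qed
    next
      fix x assume "x \<in> Pair 0 ` ?B k \<union> (\<lambda>(i, p). (Suc i, p)) ` ?R k"
      then show "x \<in> ?Q k"
      proof
        assume "x \<in> (\<lambda>(i, p). (Suc i, p)) ` ?R k"
        then obtain i j l where "x = (Suc i, j, l)" "(i, j, l) \<in> ?R k" by fast
        then show ?thesis by (simp add: tail_arrivals_def)
      qed (use True in auto)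
    qed
    have "card (?Q k) = card (?B k) + card (?R k)" for k
    proof -
      define B' where "B' = Pair (0::nat) ` ?B k"
      define R' where "R' = (\<lambda>(i, p). (Suc i, p)) ` ?R k"
      have Q: "?Q k = B' \<union> R'" unfolding B'_def R'_def by (rule split)
      have "finite (B' \<union> R')" using fin[of k] unfolding Q .
      moreover have "B' \<inter> R' = {}"
      proof -
        have "fst x = 0" if "x \<in> B'" for x using that unfolding B'_def by (rule imageE) simp
        moreover have "fst x \<noteq> 0" if "x \<in> R'" for x
          using that unfolding R'_def by (rule imageE) (simp split: prod.splits)
        ultimately show ?thesis by blast
      qed
      ultimately have "card (B' \<union> R') = card B' + card R'" by (intro card_Un_disjoint) auto
      moreover have "card B' = card (?B k)"
        unfolding B'_def by (rule card_image) (simp add: inj_on_def)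
      moreover have "card R' = card (?R k)"
        unfolding R'_def
      proof (rule card_image, rule inj_on_subset)
        show "inj (\<lambda>(i, p :: 'j \<times> nat). (Suc i, p))" by (rule injI) (simp split: prod.splits)
      qed simp
      ultimately show ?thesis unfolding Q by (simp only:)
    qed
    then show ?thesis
      using True unfolding queue_lengths_def census_def vec_eq_iff by (simp only: if_True vec_lambda_beta vector_add_component prod.case) simp
  qed
qed

text \<open>
  The network is empty before time \<open>0\<close>; with the value \<open>f 0\<close> there, the renewal equation needs
  no separate term for the event that no batch has arrived yet.
\<close>

definition mean_of_lengths ::
  "'w measure \<Rightarrow> (nat \<Rightarrow> 'w \<Rightarrow> real) \<Rightarrow> (nat \<Rightarrow> 'w \<Rightarrow> nat ^ 'j::finite) \<Rightarrow>
   (nat \<Rightarrow> 'j \<Rightarrow> nat \<Rightarrow> real \<Rightarrow> 'w \<Rightarrow> 'j option) \<Rightarrow> (nat ^ 'j \<Rightarrow> real) \<Rightarrow> real \<Rightarrow> real" where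
  "mean_of_lengths M T \<Sigma> X f u = (if 0 \<le> u then (\<integral>\<omega>. f (queue_lengths T \<Sigma> X u \<omega>) \<partial>M) else f 0)"

context batch_network
begin

abbreviation first_batch :: "real \<Rightarrow> 'w \<Rightarrow> nat ^ 'j" where
  "first_batch u \<omega> \<equiv> census (\<Sigma> 0 \<omega>) (\<lambda>(j, l). X 0 j l u \<omega>)"

abbreviation later_lengths :: "real \<Rightarrow> 'w \<Rightarrow> nat ^ 'j" where
  "later_lengths \<equiv> queue_lengths (tail_arrivals T) (\<lambda>i. \<Sigma> (Suc i)) (\<lambda>i. X (Suc i))"

lemma interarrival_measurable [measurable]: "interarrival T i \<in> borel_measurable M"
  using arrivals by (auto simp: poisson_points_def distributed_def)

lemma T_measurable [measurable]: "T i \<in> borel_measurable M"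
  by (rule measurable_from_sources[OF measurable_T_sources[of UNIV]]) simp

lemma AE_interarrival_nonneg: "AE \<omega> in M. \<forall>i. 0 \<le> interarrival T i \<omega>"
proof (subst AE_all_countable, intro allI)
  fix i
  have "prob {\<omega> \<in> space M. 0 < interarrival T i \<omega>} = 1"
    using exponential_distributedD_gt[of "interarrival T i" lam 0] arrivals lam_pos
    by (simp add: poisson_points_def)
  then have "AE \<omega> in M. 0 < interarrival T i \<omega>"
    by (subst (asm) prob_Collect_eq_1) auto
  then show "AE \<omega> in M. 0 \<le> interarrival T i \<omega>" by auto
qed

text \<open>
  For each bound \<open>n\<close>, the probability that the first \<open>m + 1\<close> interarrival times do not exceed it is
  the power of order \<open>m + 1\<close> of a number less than \<open>1\<close>.
\<close>

lemma AE_interarrival_unbounded: "AE \<omega> in M. \<forall>n::nat. \<exists>i. real n < interarrival T i \<omega>"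
proof (subst AE_all_countable, intro allI)
  fix n :: nat
  let ?r = "1 - exp (- (real n * lam))"
  let ?E = "{\<omega> \<in> space M. \<forall>i. interarrival T i \<omega> \<le> real n}"
  have [measurable]: "?E \<in> events" by measurable
  have "prob ?E \<le> ?r ^ Suc m" for m
  proof -
    have "prob ?E \<le> prob (\<Inter>i\<in>{..m}. interarrival T i -` {..real n} \<inter> space M)"
      by (intro finite_measure_mono) (auto intro!: sets.finite_INT)
    also have "\<dots> = (\<Prod>i\<le>m. prob (interarrival T i -` {..real n} \<inter> space M))"
      using arrivals by (intro indep_varsD[where I = UNIV and M' = "\<lambda>_. borel"]) (auto simp: poisson_points_def)
    also have "\<dots> = (\<Prod>i\<le>m. ?r)"
    proof (rule prod.cong[OF refl])
      fix i
      have "interarrival T i -` {..real n} \<inter> space M = {\<omega> \<in> space M. interarrival T i \<omega> \<le> real n}" by auto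
      then show "prob (interarrival T i -` {..real n} \<inter> space M) = ?r"
        using exponential_distributedD_le[of "interarrival T i" lam "real n"] arrivals lam_pos
        by (simp add: poisson_points_def)
    qed
    finally show ?thesis by simp
  qed
  moreover have "(\<lambda>m. ?r ^ Suc m) \<longlonglongrightarrow> 0"
    using lam_pos by (intro LIMSEQ_Suc LIMSEQ_realpow_zero) auto
  ultimately have "prob ?E \<le> 0"
    by (intro LIMSEQ_le_const) auto
  then have "prob ?E = 0" using measure_nonneg[of M ?E] by linarith
  then have "AE \<omega> in M. \<not> (\<forall>i. interarrival T i \<omega> \<le> real n)"
    by (subst (asm) prob_eq_0) (auto elim: AE_mp)
  then show "AE \<omega> in M. \<exists>i. real n < interarrival T i \<omega>" by (simp add: not_le)
qed

lemma AE_queue_lengths_first_arrival: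
  "AE \<omega> in M. queue_lengths T \<Sigma> X t \<omega> =
     (if T 0 \<omega> \<le> t then first_batch (t - T 0 \<omega>) \<omega> + later_lengths (t - T 0 \<omega>) \<omega> else 0)"
  using AE_interarrival_nonneg AE_interarrival_unbounded
proof eventually_elim
  case (elim \<omega>)
  obtain n :: nat where "t < real n" using reals_Archimedean2 by blast
  then have "\<exists>i. t < interarrival T i \<omega>" using elim(2) less_trans by blast
  then show ?case using elim(1) by (intro queue_lengths_first_arrival) auto
qed

abbreviation mean :: "(nat ^ 'j \<Rightarrow> real) \<Rightarrow> real \<Rightarrow> real" where
  "mean \<equiv> mean_of_lengths M T \<Sigma> X"

definition mean_after_batch :: "(nat ^ 'j \<Rightarrow> real) \<Rightarrow> real \<Rightarrow> real" where
  "mean_after_batch f u =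
     (if 0 \<le> u then expectation (\<lambda>\<omega>. f (first_batch u \<omega> + later_lengths u \<omega>)) else f 0)"

lemma measurable_batch_and_later:
  fixes f :: "nat ^ 'j \<Rightarrow> real"
  shows "(\<lambda>(u, \<omega>). if 0 \<le> u then f (first_batch u \<omega> + later_lengths u \<omega>) else f 0)
    \<in> borel_measurable (borel \<Otimes>\<^sub>M sources M (tail_arrivals T) \<Sigma> X UNIV)"
proof -
  interpret R: batch_network M lam "tail_arrivals T" \<Sigma> S X q
    using tail_network[of "\<lambda>i. i"] by simp
  let ?G = "sources M (tail_arrivals T) \<Sigma> X UNIV"
  let ?pos = "\<lambda>p :: real \<times> 'w. (max 0 (fst p), snd p)"
  have pos: "?pos \<in> measurable (borel \<Otimes>\<^sub>M ?G) (restrict_space borel {0..} \<Otimes>\<^sub>M ?G)"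
    by (rule measurable_Pair[OF measurable_restrict_space2 measurable_snd]) simp_all
  have "(\<lambda>(t, \<omega>). first_batch t \<omega>) \<in> measurable (restrict_space borel {0..} \<Otimes>\<^sub>M ?G) (count_space UNIV)"
    by (rule R.measurable_census_sources) auto
  from measurable_compose[OF pos this]
  have [measurable]: "(\<lambda>p. first_batch (max 0 (fst p)) (snd p)) \<in> measurable (borel \<Otimes>\<^sub>M ?G) (count_space UNIV)"
    by (simp add: case_prod_unfold)
  have "(\<lambda>(t, \<omega>). later_lengths t \<omega>) \<in> measurable (restrict_space borel {0..} \<Otimes>\<^sub>M ?G) (count_space UNIV)"
    by (intro measurable_queue_lengths R.measurable_T_sources R.measurable_\<Sigma>_sources R.measurable_X_sources) auto
  from measurable_compose[OF pos this]
  have [measurable]: "(\<lambda>p. later_lengths (max 0 (fst p)) (snd p)) \<in> measurable (borel \<Otimes>\<^sub>M ?G) (count_space UNIV)"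
    by (simp add: case_prod_unfold)
  have [measurable]: "(\<lambda>p. f (first_batch (max 0 (fst p)) (snd p) + later_lengths (max 0 (fst p)) (snd p)))
      \<in> borel_measurable (borel \<Otimes>\<^sub>M ?G)"
    by (rule measurable_countable_binary[of _ _ _ "\<lambda>b n. f (b + n)"]) simp_all
  have "(\<lambda>p. if 0 \<le> fst p then f (first_batch (max 0 (fst p)) (snd p) + later_lengths (max 0 (fst p)) (snd p)) else f 0)
      \<in> borel_measurable (borel \<Otimes>\<^sub>M ?G)"
    by (intro measurable_If) simp_all
  also have "?this \<longleftrightarrow> ?thesis"
    by (intro arg_cong2[where f = "(\<in>)"] refl) (auto simp: fun_eq_iff)
  finally show ?thesis .
qed

lemma mean_after_batch_eq:
  "mean_after_batch f u = expectation (\<lambda>\<omega>. if 0 \<le> u then f (first_batch u \<omega> + later_lengths u \<omega>) else f 0)"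
  by (simp add: mean_after_batch_def prob_space)

lemma sets_sources_tail_le:
  "sets (sources M (tail_arrivals T) \<Sigma> X A) \<subseteq> events"
proof -
  interpret R: batch_network M lam "tail_arrivals T" \<Sigma> S X q
    using tail_network[of "\<lambda>i. i"] by simp
  show ?thesis by (rule R.sets_sources_le)
qed

lemma mean_after_batch_measurable [measurable]:
  "mean_after_batch f \<in> borel_measurable borel"
  unfolding mean_after_batch_eq[abs_def]
  by (rule measurable_expectation_section[OF _ _ measurable_batch_and_later]) (auto simp: sets_sources_tail_le)

lemma abs_mean_le:
  assumes "\<And>x. \<bar>f x\<bar> \<le> c"
  shows "\<bar>mean f u\<bar> \<le> c"
  using assms abs_expectation_le[of "\<lambda>\<omega>. f (queue_lengths T \<Sigma> X u \<omega>)" c] by (simp add: mean_of_lengths_def)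

lemma abs_mean_after_batch_le:
  assumes "\<And>x. \<bar>f x\<bar> \<le> c"
  shows "\<bar>mean_after_batch f u\<bar> \<le> c"
  using assms abs_expectation_le[of "\<lambda>\<omega>. f (first_batch u \<omega> + later_lengths u \<omega>)" c] by (simp add: mean_after_batch_def)

text \<open>
  Conditioning on the first arrival epoch, which is independent of the batches, of the itineraries and
  of the later epochs measured from it.
\<close>

lemma mean_renewal:
  assumes bounded: "\<And>x. \<bar>f x\<bar> \<le> c"
  shows "mean f t = (\<integral>s. mean_after_batch f (t - s) \<partial>density lborel (exponential_density lam))"
proof -
  let ?G = "sources M (tail_arrivals T) \<Sigma> X UNIV"
  let ?H = "\<lambda>u \<omega>. if 0 \<le> u then f (first_batch u \<omega> + later_lengths u \<omega>) else f 0"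
  have T0: "distributed M lborel (T 0) (exponential_density lam)"
    using arrivals unfolding poisson_points_def by (metis interarrival.simps(1) ext)
  have AE_eq: "AE \<omega> in M. (if 0 \<le> t then f (queue_lengths T \<Sigma> X t \<omega>) else f 0) = ?H (t - T 0 \<omega>) \<omega>"
    using AE_queue_lengths_first_arrival[of t] AE_interarrival_nonneg
  proof eventually_elim
    case (elim \<omega>)
    then have "0 \<le> T 0 \<omega>" by (metis interarrival.simps(1))
    then show ?case using elim(1) by auto
  qed
  have meas: "(\<lambda>(s, \<omega>). ?H (t - s) \<omega>) \<in> borel_measurable (borel \<Otimes>\<^sub>M ?G)"
  proof -
    have "(\<lambda>p. (t - fst p, snd p)) \<in> measurable (borel \<Otimes>\<^sub>M ?G) (borel \<Otimes>\<^sub>M ?G)" by measurable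
    from measurable_compose[OF this measurable_batch_and_later[of f]]
    show ?thesis by (simp only: case_prod_unfold fst_conv snd_conv)
  qed
  have "(\<lambda>\<omega>. (T 0 \<omega>, \<omega>)) \<in> measurable M (borel \<Otimes>\<^sub>M ?G)"
    by (intro measurable_Pair T_measurable) (use sets_sources_tail_le in \<open>auto simp: measurable_def\<close>)
  from measurable_compose[OF this meas]
  have meas_T: "(\<lambda>\<omega>. ?H (t - T 0 \<omega>) \<omega>) \<in> borel_measurable M" by simp
  have meas_l: "(\<lambda>\<omega>. if 0 \<le> t then f (queue_lengths T \<Sigma> X t \<omega>) else f 0) \<in> borel_measurable M"
    using measurable_compose[OF measurable_from_sources[OF measurable_queue_lengths_at[of t]], of f borel] by (cases "0 \<le> t") simp_all
  have "mean f t = expectation (\<lambda>\<omega>. if 0 \<le> t then f (queue_lengths T \<Sigma> X t \<omega>) else f 0)"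
    by (simp add: mean_of_lengths_def prob_space)
  also have "\<dots> = expectation (\<lambda>\<omega>. ?H (t - T 0 \<omega>) \<omega>)"
    by (rule integral_cong_AE[OF meas_l meas_T AE_eq])
  also have "\<dots> = (\<integral>s. expectation (?H (t - s)) \<partial>distr M borel (T 0))"
  proof (rule expectation_indep[where F = "vimage_algebra (space M) (T 0) borel" and G = ?G and c = c])
    show "indep_set (sets (vimage_algebra (space M) (T 0) borel)) (sets ?G)" by (rule indep_first_arrival)
    show "sets (vimage_algebra (space M) (T 0) borel) \<subseteq> events"
      by (subst sets_vimage_algebra2) auto
    show "T 0 \<in> borel_measurable (vimage_algebra (space M) (T 0) borel)"
      by (rule measurable_vimage_algebra1) auto
  qed (use bounded sets_sources_tail_le meas in auto)
  also have "distr M borel (T 0) = density lborel (exponential_density lam)"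
    using distributed_distr_eq_density[OF T0] by (simp cong: distr_cong)
  finally show ?thesis by (simp add: mean_after_batch_eq)
qed

lemma first_batch_measurable_sources:
  assumes "u \<ge> 0"
  shows "first_batch u \<in> measurable (sources M T \<Sigma> X (insert (Batch 0) {Customer 0 j l |j l. True})) (count_space UNIV)"
    (is "_ \<in> measurable ?F _")
proof -
  have "(\<lambda>\<omega>. (u, \<omega>)) \<in> measurable ?F (restrict_space borel {0..} \<Otimes>\<^sub>M ?F)"
    using assms by (intro measurable_Pair measurable_const) (auto simp: space_restrict_space)
  from measurable_compose[OF this measurable_census_sources] show ?thesis by simp
qed

text \<open>
  At a fixed age the first batch and the later ones are functions of disjoint sets of sources.
\<close>

lemma mean_after_batch_independent:
  assumes bounded: "\<And>x. \<bar>f x\<bar> \<le> c" and u: "u \<ge> 0"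
  shows "mean_after_batch f u =
    (\<integral>b. expectation (\<lambda>\<omega>. f (b + later_lengths u \<omega>)) \<partial>distr M (count_space UNIV) (first_batch u))"
proof -
  interpret L: batch_network M lam "tail_arrivals T" "\<lambda>i. \<Sigma> (Suc i)" S "\<lambda>i. X (Suc i)" q
    by (rule tail_network) simp
  let ?A = "insert (Batch 0) {Customer 0 j l |j l. True}"
  let ?F = "sources M T \<Sigma> X ?A"
  let ?G = "sources M (tail_arrivals T) (\<lambda>i. \<Sigma> (Suc i)) (\<lambda>i. X (Suc i)) UNIV"
  have "?A \<inter> range (renumber Suc) = {}"
  proof (rule equals0I)
    fix x assume x: "x \<in> ?A \<inter> range (renumber Suc)"
    then obtain a where "x = renumber Suc a" by blast
    then show False using x by (cases a) auto
  qed
  then have "indep_set (sets ?F) (sets (sources M T \<Sigma> X (range (renumber Suc))))"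
    by (rule indep_sources)
  then have "indep_set (sets ?F) (sets ?G)"
    unfolding indep_set_def
  proof (rule indep_sets_mono_sets)
    fix b show "case_bool (sets ?F) (sets ?G) b \<subseteq> case_bool (sets ?F) (sets (sources M T \<Sigma> X (range (renumber Suc)))) b"
      using sets_sources_tail[of Suc UNIV] by (cases b) simp_all
  qed
  then have "expectation (\<lambda>\<omega>. f (first_batch u \<omega> + later_lengths u \<omega>)) =
    (\<integral>b. expectation (\<lambda>\<omega>. f (b + later_lengths u \<omega>)) \<partial>distr M (count_space UNIV) (first_batch u))"
  proof (rule expectation_indep[rotated 4, where c = c])
    have [measurable]: "later_lengths u \<in> measurable ?G (count_space UNIV)"
      by (rule L.measurable_queue_lengths_at[OF u])
    have "(\<lambda>p. f (fst p + later_lengths u (snd p))) \<in> borel_measurable (count_space UNIV \<Otimes>\<^sub>M ?G)"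
      by (rule measurable_countable_binary[of _ _ _ "\<lambda>b n. f (b + n)"]) simp_all
    then show "(\<lambda>(b, \<omega>). f (b + later_lengths u \<omega>)) \<in> borel_measurable (count_space UNIV \<Otimes>\<^sub>M ?G)"
      by (simp add: case_prod_unfold)
  qed (use bounded first_batch_measurable_sources[OF u] L.sets_sources_le sets_sources_le in auto)
  then show ?thesis using u by (simp add: mean_after_batch_def)
qed

end

section \<open>Analysis of exponential renewal equations\<close>

lemma exponential_density_has_integral:
  assumes "0 < lam"
  shows "has_bochner_integral lborel (exponential_density lam) 1"
proof (rule has_bochner_integral_nn_integral)
  interpret E: prob_space "density lborel (exponential_density lam)"
    by (rule prob_space_exponential_density[OF assms])
  show "(\<integral>\<^sup>+x. ennreal (exponential_density lam x) \<partial>lborel) = ennreal 1"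
    using E.emeasure_space_1 by (simp add: emeasure_density)
qed (use assms in \<open>auto simp: exponential_density_nonneg\<close>)

lemma measure_exponential_atMost:
  assumes "0 < lam" "0 \<le> t"
  shows "measure (density lborel (exponential_density lam)) {..t} = 1 - exp (- lam * t)"
  using assms by (simp add: measure_def emeasure_erlang_density erlang_CDF_0)

text \<open>
  With \<open>e\<close> the exponential density, \<open>F\<close> is the convolution of \<open>e\<close> and \<open>G\<close>.  The derivative of
  \<open>e\<close> away from its jump of height \<open>lam\<close> at \<open>0\<close> is \<open>- lam * e\<close>, so formally the derivative of
  \<open>F\<close> is \<open>lam * (G - F)\<close>.  As \<open>G\<close> is only measurable, the integrated form is obtained instead by
  integrating \<open>F\<close> over \<open>{a<..b}\<close> and exchanging the two integrals; \<open>P\<close> is the distribution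
  function of \<open>e\<close> and \<open>P_eq\<close> is the differential equation of \<open>e\<close> in integrated form.
\<close>

lemma exponential_renewal_increment:
  fixes F G :: "real \<Rightarrow> real"
  assumes lam: "0 < lam" and G [measurable]: "G \<in> borel_measurable borel" and bounded: "\<And>u. \<bar>G u\<bar> \<le> c"
    and F: "\<And>t. F t = (\<integral>s. G (t - s) \<partial>density lborel (exponential_density lam))"
    and ab: "a \<le> b"
  shows "set_integrable lborel {a<..b} (\<lambda>u. G u - F u)"
    and "F b - F a = lam * (LINT u:{a<..b}|lborel. G u - F u)"
proof -
  let ?e = "exponential_density lam"
  let ?E = "density lborel ?e"
  define P where "P x = measure ?E {..x}" for x
  interpret E: prob_space ?E by (rule prob_space_exponential_density[OF lam])
  have e_nonneg [simp]: "0 \<le> ?e x" for x using lam by (rule exponential_density_nonneg)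
  have e_int: "integrable lborel ?e" and e_1: "integral\<^sup>L lborel ?e = 1"
    using exponential_density_has_integral[OF lam] by (auto simp: has_bochner_integral_iff)
  have e_refl_int: "integrable lborel (\<lambda>u. ?e (t - u))" and e_refl_1: "(\<integral>u. ?e (t - u) \<partial>lborel) = 1" for t
    using lborel_integrable_real_affine[OF e_int, of "-1" t] lborel_integral_real_affine[of "-1" ?e t] e_1
    by (simp_all)
  have eG_int: "integrable lborel (\<lambda>u. ?e (t - u) * G u)" for t
  proof (rule Bochner_Integration.integrable_bound[OF integrable_mult_right[OF e_refl_int[of t], of c]])
    show "AE u in lborel. norm (?e (t - u) * G u) \<le> norm (c * ?e (t - u))"
    proof (rule AE_I2)
      fix u
      have "\<bar>G u\<bar> \<le> \<bar>c\<bar>" using bounded[of u] by linarith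
      then show "norm (?e (t - u) * G u) \<le> norm (c * ?e (t - u))"
        by (simp add: abs_mult mult.commute mult_right_mono)
    qed
  qed measurable
  have F_eq: "F t = (\<integral>u. ?e (t - u) * G u \<partial>lborel)" for t
  proof -
    have "F t = (\<integral>s. ?e s * G (t - s) \<partial>lborel)"
      unfolding F by (subst integral_density) auto
    also have "\<dots> = (\<integral>u. ?e (t - u) * G u \<partial>lborel)"
      by (subst lborel_integral_real_affine[of "-1" _ t]) simp_all
    finally show ?thesis .
  qed
  have P_eq: "lam * P x = lam * indicator {0..} x - ?e x" for x
  proof (cases "x < 0")
    case True
    then have "emeasure ?E {..x} = 0"
      using lam by (simp add: emeasure_erlang_density erlang_CDF_0)
    then show ?thesis using True by (simp add: P_def measure_def exponential_density_def)
  next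
    case False
    then have P_x: "P x = 1 - exp (- lam * x)"
      unfolding P_def by (intro measure_exponential_atMost lam) simp
    show ?thesis unfolding P_x using False by (simp add: exponential_density_def algebra_simps)
  qed
  have kernel: "(\<integral>v. indicator {a<..b} v * ?e (v - u) \<partial>lborel) = P (b - u) - P (a - u)" for u
  proof -
    have "(\<integral>v. indicator {a<..b} v * ?e (v - u) \<partial>lborel) = (\<integral>s. ?e s * indicator {a - u<..b - u} s \<partial>lborel)"
      by (subst lborel_integral_real_affine[of 1 _ u])
        (auto intro!: Bochner_Integration.integral_cong split: split_indicator)
    also have "\<dots> = (\<integral>s. indicator {a - u<..b - u} s \<partial>?E)"
      by (subst integral_density) auto
    also have "\<dots> = measure ?E {a - u<..b - u}" by simp
    also have "{a - u<..b - u} = {..b - u} - {..a - u}" by auto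
    also have "measure ?E \<dots> = P (b - u) - P (a - u)"
      unfolding P_def using ab by (intro E.finite_measure_Diff) auto
    finally show ?thesis .
  qed
  let ?k = "\<lambda>(v, u). indicator {a<..b} v * ?e (v - u)"
  let ?K = "\<lambda>(v, u). indicator {a<..b} v * (?e (v - u) * G u)"
  have k_int: "integrable (lborel \<Otimes>\<^sub>M lborel) ?k"
  proof (rule lborel_pair.Fubini_integrable)
    have norm_k: "(\<lambda>v. \<integral>u. norm (?k (v, u)) \<partial>lborel) = indicator {a<..b}"
      by (rule ext) (simp add: abs_mult e_refl_1)
    show "integrable lborel (\<lambda>v. \<integral>u. norm (?k (v, u)) \<partial>lborel)"
      unfolding norm_k using ab by (intro integrable_real_indicator) auto
    show "AE v in lborel. integrable lborel (\<lambda>u. ?k (v, u))"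
      by (auto intro!: e_refl_int)
  qed measurable
  have K_int: "integrable (lborel \<Otimes>\<^sub>M lborel) ?K"
  proof (rule Bochner_Integration.integrable_bound[OF integrable_mult_right[OF k_int, of c]])
    show "AE p in lborel \<Otimes>\<^sub>M lborel. norm (?K p) \<le> norm (c * ?k p)"
    proof (rule AE_I2, clarify)
      fix v u
      have "\<bar>G u\<bar> \<le> \<bar>c\<bar>" using bounded[of u] by linarith
      then have "?e (v - u) * \<bar>G u\<bar> \<le> \<bar>c\<bar> * ?e (v - u)"
        by (simp add: mult.commute mult_right_mono)
      then show "norm (indicator {a<..b} v * (?e (v - u) * G u)) \<le> norm (c * (indicator {a<..b} v * ?e (v - u)))"
        by (auto simp: abs_mult split: split_indicator)
    qed
  qed measurable
  have F_int: "integrable lborel (\<lambda>v. indicator {a<..b} v * F v)"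
    using lborel_pair.integrable_fst'[OF K_int] by (simp add: F_eq)
  have G_int: "integrable lborel (\<lambda>u. indicator {a<..b} u * G u)"
  proof (rule Bochner_Integration.integrable_bound)
    show "integrable lborel (\<lambda>u. c * indicat_real {a<..b} u)"
      using ab by (intro integrable_mult_right integrable_real_indicator) auto
    show "AE u in lborel. norm (indicator {a<..b} u * G u) \<le> norm (c * indicat_real {a<..b} u)"
    proof (rule AE_I2)
      fix u
      have "\<bar>G u\<bar> \<le> \<bar>c\<bar>" using bounded[of u] by linarith
      then show "norm (indicator {a<..b} u * G u) \<le> norm (c * indicat_real {a<..b} u)"
        by (auto simp: abs_mult split: split_indicator)
    qed
  qed measurable
  have GF: "indicator {a<..b} u *\<^sub>R (G u - F u) = indicator {a<..b} u * G u - indicator {a<..b} u * F u" for u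
    by (simp add: algebra_simps)
  show "set_integrable lborel {a<..b} (\<lambda>u. G u - F u)"
    unfolding set_integrable_def GF using F_int G_int by simp
  have "lam * (\<integral>v. indicator {a<..b} v * F v \<partial>lborel) = lam * (\<integral>v. (\<integral>u. ?K (v, u) \<partial>lborel) \<partial>lborel)"
    by (simp add: F_eq)
  also have "\<dots> = lam * (\<integral>u. (\<integral>v. ?K (v, u) \<partial>lborel) \<partial>lborel)"
    using lborel_pair.Fubini_integral[of "\<lambda>v u. ?K (v, u)"] K_int by simp
  also have "(\<lambda>u. \<integral>v. ?K (v, u) \<partial>lborel) = (\<lambda>u. (P (b - u) - P (a - u)) * G u)"
    by (simp add: kernel[symmetric] mult.assoc[symmetric])
  also have "lam * (\<integral>u. (P (b - u) - P (a - u)) * G u \<partial>lborel) = (\<integral>u. lam * ((P (b - u) - P (a - u)) * G u) \<partial>lborel)"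
    by simp
  also have "\<dots> = (\<integral>u. lam * (indicator {a<..b} u * G u) - ?e (b - u) * G u + ?e (a - u) * G u \<partial>lborel)"
  proof (rule Bochner_Integration.integral_cong[OF refl])
    fix u
    have "lam * ((P (b - u) - P (a - u)) * G u) = (lam * P (b - u) - lam * P (a - u)) * G u"
      by (simp add: algebra_simps)
    also have "\<dots> = lam * ((indicator {0..} (b - u) - indicator {0..} (a - u)) * G u) - ?e (b - u) * G u + ?e (a - u) * G u"
      unfolding P_eq by (simp add: algebra_simps)
    also have "indicator {0..} (b - u) - indicator {0..} (a - u) = (indicator {a<..b} u :: real)"
      using ab by (auto split: split_indicator)
    finally show "lam * ((P (b - u) - P (a - u)) * G u) = lam * (indicator {a<..b} u * G u) - ?e (b - u) * G u + ?e (a - u) * G u" .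
  qed
  also have "\<dots> = lam * (\<integral>u. indicator {a<..b} u * G u \<partial>lborel) - F b + F a"
    using G_int eG_int by (simp add: F_eq)
  finally show "F b - F a = lam * (LINT u:{a<..b}|lborel. G u - F u)"
    unfolding set_lebesgue_integral_def GF using F_int G_int by (simp add: algebra_simps)
qed

text \<open>
  The integrand is bounded by \<open>1\<close> up to the time \<open>m = ln (y + 1) / \<delta>\<close>, at which
  \<open>(y + 1) * exp (- \<delta> * u)\<close> has decreased to \<open>1\<close>, and by a decaying exponential of rate \<open>\<delta>\<close>
  afterwards.
\<close>

lemma nn_integral_truncated_exponential:
  fixes y :: real
  assumes "0 < \<delta>" "0 \<le> y"
  shows "(\<integral>\<^sup>+u. ennreal (indicator {0..} u * min 1 (y * exp (- \<delta> * u))) \<partial>lborel) \<le> ennreal (ln (y + 1) / \<delta> + 1 / \<delta>)"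
proof -
  define m where "m = ln (y + 1) / \<delta>"
  have m: "0 \<le> m" using assms by (simp add: m_def)
  let ?r = "\<lambda>u. indicator {0..m} u + 1 / \<delta> * exponential_density \<delta> (u - m)"
  have e: "integrable lborel (\<lambda>u. exponential_density \<delta> (u - m))" "(\<integral>u. exponential_density \<delta> (u - m) \<partial>lborel) = 1"
    using exponential_density_has_integral[OF assms(1)]
      lborel_integrable_real_affine[of "exponential_density \<delta>" 1 "-m"] lborel_integral_real_affine[of 1 "exponential_density \<delta>" "-m"]
    by (auto simp: has_bochner_integral_iff)
  have ind: "integrable lborel (indicat_real {0..m})"
    using m by (intro integrable_real_indicator) auto
  have "indicator {0..} u * min 1 (y * exp (- \<delta> * u)) \<le> ?r u" for u
  proof (cases "0 \<le> u")
    case True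
    show ?thesis
    proof (cases "u < m")
      case True
      then show ?thesis using \<open>0 \<le> u\<close> by (simp add: exponential_density_def)
    next
      case False
      have "exp (- ((u - m) * \<delta>)) = exp (\<delta> * m) * exp (- \<delta> * u)"
        unfolding exp_add[symmetric] by (simp add: algebra_simps)
      also have "exp (\<delta> * m) = y + 1" using assms by (simp add: m_def)
      finally have "y * exp (- \<delta> * u) \<le> exp (- ((u - m) * \<delta>))" by (simp add: mult_right_mono)
      then have "min 1 (y * exp (- \<delta> * u)) \<le> exp (- ((u - m) * \<delta>))" by linarith
      moreover have "1 / \<delta> * exponential_density \<delta> (u - m) = exp (- ((u - m) * \<delta>))"
        using False assms(1) by (simp add: exponential_density_def algebra_simps)
      moreover have "0 \<le> (indicator {0..m} u :: real)" by simp
      ultimately have "min 1 (y * exp (- \<delta> * u)) \<le> ?r u" by linarith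
      then show ?thesis using \<open>0 \<le> u\<close> by simp
    qed
  next
    case False
    then show ?thesis using assms(1) m by (simp add: exponential_density_def)
  qed
  then have "(\<integral>\<^sup>+u. ennreal (indicator {0..} u * min 1 (y * exp (- \<delta> * u))) \<partial>lborel) \<le> (\<integral>\<^sup>+u. ennreal (?r u) \<partial>lborel)"
    by (intro nn_integral_mono ennreal_leI)
  also have "\<dots> = ennreal (\<integral>u. ?r u \<partial>lborel)"
    using assms(1) by (intro nn_integral_eq_integral Bochner_Integration.integrable_add integrable_mult_right e ind)
      (auto simp: exponential_density_nonneg)
  also have "(\<integral>u. ?r u \<partial>lborel) = m + 1 / \<delta>"
    using e ind m by (subst Bochner_Integration.integral_add) auto
  finally show ?thesis by (simp add: m_def)
qed

lemma (in prob_space) integrable_expected_truncated_exponential: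
  fixes Y :: "'a \<Rightarrow> real"
  assumes \<delta>: "0 < \<delta>" and Y [measurable]: "Y \<in> borel_measurable M" and nonneg: "\<And>\<omega>. 0 \<le> Y \<omega>"
    and log: "integrable M (\<lambda>\<omega>. ln (Y \<omega> + 1))"
  shows "integrable lborel (\<lambda>u. indicator {0..} u * expectation (\<lambda>\<omega>. min 1 (Y \<omega> * exp (- \<delta> * u))))"
proof (rule integrableI_bounded)
  interpret P: pair_sigma_finite lborel M ..
  let ?m = "\<lambda>u \<omega>. min 1 (Y \<omega> * exp (- \<delta> * u))"
  have m_nonneg: "0 \<le> ?m u \<omega>" for u \<omega> using nonneg by simp
  have m_int: "integrable M (?m u)" for u
    by (rule integrable_const_bound[of _ 1]) (use m_nonneg in \<open>auto simp: abs_of_nonneg\<close>)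
  show "(\<lambda>u. indicator {0..} u * expectation (?m u)) \<in> borel_measurable lborel" by measurable
  have "(\<integral>\<^sup>+u. ennreal (norm (indicator {0..} u * expectation (?m u))) \<partial>lborel)
      = (\<integral>\<^sup>+u. (\<integral>\<^sup>+\<omega>. ennreal (indicator {0..} u * ?m u \<omega>) \<partial>M) \<partial>lborel)"
  proof (rule nn_integral_cong)
    fix u
    have "(\<integral>\<^sup>+\<omega>. ennreal (indicator {0..} u * ?m u \<omega>) \<partial>M) = ennreal (expectation (\<lambda>\<omega>. indicator {0..} u * ?m u \<omega>))"
      using m_int[of u] m_nonneg by (intro nn_integral_eq_integral integrable_mult_right) auto
    moreover have "0 \<le> expectation (?m u)" using m_nonneg by (simp add: integral_nonneg)
    ultimately show "ennreal (norm (indicator {0..} u * expectation (?m u))) = (\<integral>\<^sup>+\<omega>. ennreal (indicator {0..} u * ?m u \<omega>) \<partial>M)"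
      by (simp add: abs_mult)
  qed
  also have "\<dots> = (\<integral>\<^sup>+\<omega>. (\<integral>\<^sup>+u. ennreal (indicator {0..} u * ?m u \<omega>) \<partial>lborel) \<partial>M)"
    by (rule P.Fubini'[symmetric]) measurable
  also have "\<dots> \<le> (\<integral>\<^sup>+\<omega>. ennreal (ln (Y \<omega> + 1) / \<delta> + 1 / \<delta>) \<partial>M)"
    by (intro nn_integral_mono nn_integral_truncated_exponential \<delta> nonneg)
  also have "\<dots> < \<infinity>"
  proof -
    have "integrable M (\<lambda>\<omega>. ln (Y \<omega> + 1) / \<delta> + 1 / \<delta>)" using log by simp
    then have "(\<integral>\<^sup>+\<omega>. ennreal (norm (ln (Y \<omega> + 1) / \<delta> + 1 / \<delta>)) \<partial>M) < \<infinity>"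
      by (simp add: integrable_iff_bounded)
    moreover have "norm (ln (Y \<omega> + 1) / \<delta> + 1 / \<delta>) = ln (Y \<omega> + 1) / \<delta> + 1 / \<delta>" for \<omega>
      using \<delta> nonneg[of \<omega>] by simp
    ultimately show ?thesis by simp
  qed
  finally show "(\<integral>\<^sup>+u. ennreal (norm (indicator {0..} u * expectation (?m u))) \<partial>lborel) < \<infinity>" .
qed

lemma tail_integral_tendsto_0:
  fixes p :: "real \<Rightarrow> real"
  assumes "integrable lborel p"
  shows "((\<lambda>a. LINT u:{a<..}|lborel. p u) \<longlongrightarrow> 0) at_top"
proof -
  have [measurable]: "p \<in> borel_measurable borel" using assms by auto
  have "((\<lambda>a. \<integral>u. indicator {a<..} u *\<^sub>R p u \<partial>lborel) \<longlongrightarrow> (\<integral>u. 0 \<partial>(lborel :: real measure))) at_top"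
  proof (rule integral_dominated_convergence_at_top[where w = "\<lambda>u. norm (p u)"])
    show "AE u in lborel. ((\<lambda>a. indicator {a<..} u *\<^sub>R p u) \<longlongrightarrow> 0) at_top"
    proof (rule AE_I2)
      fix u :: real
      have "\<forall>\<^sub>F a in at_top. indicator {a<..} u *\<^sub>R p u = 0"
        using eventually_ge_at_top[of u] by eventually_elim simp
      then show "((\<lambda>a. indicator {a<..} u *\<^sub>R p u) \<longlongrightarrow> 0) at_top" by (rule tendsto_eventually)
    qed
  qed (use assms in \<open>auto intro!: always_eventually split: split_indicator\<close>)
  then show ?thesis by (simp add: set_lebesgue_integral_def)
qed

section \<open>The law of the queue lengths is determined by the parameters\<close>

context batch_network
begin

lemma later_network: "batch_network M lam (tail_arrivals T) (\<lambda>i. \<Sigma> (Suc i)) S (\<lambda>i. X (Suc i)) q"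
  by (rule tail_network) simp

lemma prob_still_present:
  assumes "u \<ge> 0"
  shows "prob {\<omega> \<in> space M. X i j l u \<omega> \<noteq> None} = occupancy_tail q j u"
proof -
  note [measurable] = X_random[OF assms, of i j l]
  have "{\<omega> \<in> space M. X i j l u \<omega> \<noteq> None} = (\<Union>k. {\<omega> \<in> space M. X i j l u \<omega> = Some k})" by auto
  also have "prob \<dots> = (\<Sum>k\<in>UNIV. prob {\<omega> \<in> space M. X i j l u \<omega> = Some k})"
    by (rule finite_measure_finite_Union) (auto simp: disjoint_family_on_def)
  finally show ?thesis using X_prob[OF assms] by (simp add: occupancy_tail_def)
qed

lemma emeasure_position:
  assumes "u \<ge> 0"
  shows "emeasure (distr M (count_space UNIV) (X i j l u)) {a} =
    ennreal (case a of None \<Rightarrow> 1 - occupancy_tail q j u | Some k \<Rightarrow> q j k u)"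
proof -
  note [measurable] = X_random[OF assms, of i j l]
  have eq: "X i j l u -` {a} \<inter> space M = {\<omega> \<in> space M. X i j l u \<omega> = a}" by auto
  have "prob {\<omega> \<in> space M. X i j l u \<omega> = a} = (case a of None \<Rightarrow> 1 - occupancy_tail q j u | Some k \<Rightarrow> q j k u)"
  proof (cases a)
    case None
    have "{\<omega> \<in> space M. X i j l u \<omega> = None} = space M - {\<omega> \<in> space M. X i j l u \<omega> \<noteq> None}" by auto
    then show ?thesis using None prob_still_present[OF assms, of i j l] by (simp add: prob_compl)
  next
    case (Some k)
    then show ?thesis using X_prob[OF assms] by simp
  qed
  then show ?thesis by (simp add: emeasure_distr eq emeasure_eq_measure)
qed

text \<open>
  At a fixed age the positions of the customers of the first batch are independent, so their joint law
  is the product of the marginals.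
\<close>

lemma distr_itineraries:
  assumes u: "u \<ge> 0"
  shows "distr M (\<Pi>\<^sub>M p\<in>UNIV. count_space UNIV) (\<lambda>\<omega> p. X 0 (fst p) (snd p) u \<omega>)
    = (\<Pi>\<^sub>M p\<in>UNIV. distr M (count_space UNIV) (X 0 (fst p) (snd p) u))"
proof -
  have "indep_sets (\<lambda>p. sets (source_algebra M T \<Sigma> X (Customer 0 (fst p) (snd p)))) UNIV"
    by (rule indep_sets_reindex[of "\<lambda>p. Customer 0 (fst p) (snd p)", OF _ independent])
      (auto simp: inj_on_def prod_eq_iff)
  then have "indep_sets (\<lambda>p. {X 0 (fst p) (snd p) u -` A \<inter> space M |A. A \<in> sets (count_space UNIV)}) UNIV"
  proof (rule indep_sets_mono_sets)
    fix p :: "'j \<times> nat"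
    show "{X 0 (fst p) (snd p) u -` A \<inter> space M |A. A \<in> sets (count_space UNIV)}
      \<subseteq> sets (source_algebra M T \<Sigma> X (Customer 0 (fst p) (snd p)))"
      using measurable_sets[OF measurable_X_at_history[OF u, of 0 "fst p" "snd p"]]
      unfolding space_source_algebra by blast
  qed
  then have "indep_vars (\<lambda>_. count_space UNIV) (\<lambda>p. X 0 (fst p) (snd p) u) UNIV"
    unfolding indep_vars_def2 using X_random[OF u] by blast
  then show ?thesis
    by (subst (asm) indep_vars_iff_distr_eq_PiM) (use X_random[OF u] in \<open>auto simp: restrict_def\<close>)
qed

text \<open>
  The size of the first batch is independent of the itineraries of its potential customers.
\<close>

lemma expectation_first_batch:
  fixes h :: "nat ^ 'j \<Rightarrow> real"
  assumes u: "u \<ge> 0" and bounded: "\<And>x. \<bar>h x\<bar> \<le> c"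
  shows "expectation (\<lambda>\<omega>. h (first_batch u \<omega>)) =
    (\<integral>s. expectation (\<lambda>\<omega>. h (census s (\<lambda>(j, l). X 0 j l u \<omega>))) \<partial>distr M (count_space UNIV) S)"
proof -
  let ?F = "sources M T \<Sigma> X {Batch 0}"
  let ?G = "sources M T \<Sigma> X {Customer 0 j l |j l. True}"
  have "indep_set (sets ?F) (sets ?G)" by (rule indep_sources) auto
  then have "expectation (\<lambda>\<omega>. h (first_batch u \<omega>)) =
    (\<integral>s. expectation (\<lambda>\<omega>. h (census s (\<lambda>(j, l). X 0 j l u \<omega>))) \<partial>distr M (count_space UNIV) (\<Sigma> 0))"
  proof (rule expectation_indep[rotated 4, where c = c])
    have [measurable]: "X 0 j l u \<in> measurable ?G (count_space UNIV)" for j l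
      by (rule measurable_sources[OF _ measurable_X_at_history[OF u]]) auto
    have "(\<lambda>p. census (fst p) (\<lambda>(j, l). X 0 j l u (snd p))) \<in> measurable (count_space UNIV \<Otimes>\<^sub>M ?G) (count_space UNIV)"
      by (rule measurable_census) measurable
    from measurable_compose[OF this, of h borel]
    show "(\<lambda>(s, \<omega>). h (census s (\<lambda>(j, l). X 0 j l u \<omega>))) \<in> borel_measurable (count_space UNIV \<Otimes>\<^sub>M ?G)"
      by (simp add: case_prod_unfold)
    show "\<Sigma> 0 \<in> measurable ?F (count_space UNIV)" by (rule measurable_\<Sigma>_sources) simp
  qed (use bounded sets_sources_le in auto)
  then show ?thesis by (simp add: \<Sigma>_distr)
qed

lemma first_batch_measurable: "u \<ge> 0 \<Longrightarrow> first_batch u \<in> measurable M (count_space UNIV)"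
  by (rule measurable_from_sources[OF first_batch_measurable_sources])

text \<open>
  Given the size of the batch, this is the union bound over its customers, together with the trivial
  bound \<open>1\<close>.
\<close>

lemma prob_first_batch_nonzero:
  assumes u: "u \<ge> 0" and tail: "\<And>j. occupancy_tail q j u \<le> \<epsilon>" and "0 \<le> \<epsilon>"
  shows "prob {\<omega> \<in> space M. first_batch u \<omega> \<noteq> 0} \<le>
    expectation (\<lambda>\<omega>. min 1 (real (\<Sum>j\<in>UNIV. S \<omega> $ j) * \<epsilon>))"
proof -
  let ?h = "\<lambda>x :: nat ^ 'j. if x = 0 then 0 else 1 :: real"
  note [measurable] = X_random[OF u] first_batch_measurable[OF u] S_random
  let ?C = "\<lambda>s \<omega>. census s (\<lambda>(j, l). X 0 j l u \<omega>)"
  have [measurable]: "?C s \<in> measurable M (count_space UNIV)" for s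
    by (rule measurable_census) simp_all
  have ind: "expectation (\<lambda>\<omega>. ?h (Z \<omega>)) = prob {\<omega> \<in> space M. Z \<omega> \<noteq> 0}"
    if [measurable]: "Z \<in> measurable M (count_space UNIV)" for Z :: "'w \<Rightarrow> nat ^ 'j"
  proof -
    have "expectation (\<lambda>\<omega>. ?h (Z \<omega>)) = expectation (indicator {\<omega> \<in> space M. Z \<omega> \<noteq> 0})"
      by (rule Bochner_Integration.integral_cong) (auto simp: indicator_def)
    then show ?thesis by simp
  qed
  have bound: "prob {\<omega> \<in> space M. ?C s \<omega> \<noteq> 0} \<le> min 1 (real (\<Sum>j\<in>UNIV. s $ j) * \<epsilon>)" for s
  proof -
    let ?J = "SIGMA j:UNIV. {..<s $ j}"
    have "prob {\<omega> \<in> space M. ?C s \<omega> \<noteq> 0} \<le> prob (\<Union>p\<in>?J. {\<omega> \<in> space M. X 0 (fst p) (snd p) u \<omega> \<noteq> None})"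
    proof (rule finite_measure_mono)
      show "{\<omega> \<in> space M. ?C s \<omega> \<noteq> 0} \<subseteq> (\<Union>p\<in>?J. {\<omega> \<in> space M. X 0 (fst p) (snd p) u \<omega> \<noteq> None})"
      proof
        fix \<omega> assume \<omega>: "\<omega> \<in> {\<omega> \<in> space M. ?C s \<omega> \<noteq> 0}"
        have "\<exists>j l. l < s $ j \<and> X 0 j l u \<omega> \<noteq> None"
          by (rule ccontr) (use \<omega> census_eq_0[of s "\<lambda>(j, l). X 0 j l u \<omega>"] in auto)
        then obtain j l where "l < s $ j" "X 0 j l u \<omega> \<noteq> None" by blast
        then show "\<omega> \<in> (\<Union>p\<in>?J. {\<omega> \<in> space M. X 0 (fst p) (snd p) u \<omega> \<noteq> None})"
          using \<omega> by (intro UN_I[of "(j, l)"]) auto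
      qed
    qed auto
    also have "\<dots> \<le> (\<Sum>p\<in>?J. prob {\<omega> \<in> space M. X 0 (fst p) (snd p) u \<omega> \<noteq> None})"
      by (rule finite_measure_subadditive_finite) auto
    also have "\<dots> \<le> (\<Sum>p\<in>?J. \<epsilon>)"
      using tail by (intro sum_mono) (simp only: prob_still_present[OF u])
    also have "\<dots> = real (\<Sum>j\<in>UNIV. s $ j) * \<epsilon>" by simp
    finally show ?thesis by simp
  qed
  let ?S = "distr M (count_space UNIV) S"
  interpret S: prob_space ?S by (rule prob_space_distr) measurable
  have "prob {\<omega> \<in> space M. first_batch u \<omega> \<noteq> 0} = expectation (\<lambda>\<omega>. ?h (first_batch u \<omega>))"
    by (subst ind) simp_all
  also have "\<dots> = (\<integral>s. expectation (\<lambda>\<omega>. ?h (?C s \<omega>)) \<partial>?S)"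
    by (rule expectation_first_batch[OF u, of _ 1]) simp
  also have "\<dots> = (\<integral>s. prob {\<omega> \<in> space M. ?C s \<omega> \<noteq> 0} \<partial>?S)"
    by (subst ind) simp_all
  also have "\<dots> \<le> (\<integral>s. min 1 (real (\<Sum>j\<in>UNIV. s $ j) * \<epsilon>) \<partial>?S)"
  proof (rule integral_mono[OF _ _ bound])
    show "integrable ?S (\<lambda>s. prob {\<omega> \<in> space M. ?C s \<omega> \<noteq> 0})"
      by (rule S.integrable_const_bound[of _ 1]) auto
    show "integrable ?S (\<lambda>s. min 1 (real (\<Sum>j\<in>UNIV. s $ j) * \<epsilon>))"
    proof (rule S.integrable_const_bound[of _ 1])
      have "0 \<le> real (\<Sum>j\<in>UNIV. s $ j) * \<epsilon>" for s :: "nat ^ 'j"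
        using \<open>0 \<le> \<epsilon>\<close> by (rule mult_nonneg_nonneg[OF of_nat_0_le_iff])
      moreover have "norm (min 1 r) \<le> 1" if "0 \<le> r" for r :: real
        using that by (auto simp: min_def)
      ultimately show "AE s in ?S. norm (min 1 (real (\<Sum>j\<in>UNIV. s $ j) * \<epsilon>)) \<le> 1"
        by blast
    qed simp
  qed
  also have "\<dots> = expectation (\<lambda>\<omega>. min 1 (real (\<Sum>j\<in>UNIV. S \<omega> $ j) * \<epsilon>))"
    by (rule integral_distr) auto
  finally show ?thesis .
qed

end

text \<open>
  The law of the remains of a batch at a fixed age is obtained from the law of the batch and from the
  one-dimensional marginals of the itineraries alone.
\<close>

lemma distr_first_batch_unique:
  assumes N1: "batch_network M lam T1 \<Sigma>1 S X1 q" and N2: "batch_network M lam T2 \<Sigma>2 S X2 q" and u: "u \<ge> 0"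
  shows "distr M (count_space UNIV) (\<lambda>\<omega>. census (\<Sigma>1 0 \<omega>) (\<lambda>(j, l). X1 0 j l u \<omega>)) =
    distr M (count_space UNIV) (\<lambda>\<omega>. census (\<Sigma>2 0 \<omega>) (\<lambda>(j, l). X2 0 j l u \<omega>))"
    (is "distr M _ ?B1 = distr M _ ?B2")
proof -
  interpret N1: batch_network M lam T1 \<Sigma>1 S X1 q by (rule N1)
  interpret N2: batch_network M lam T2 \<Sigma>2 S X2 q by (rule N2)
  let ?P = "\<Pi>\<^sub>M p\<in>UNIV. count_space UNIV"
  let ?x1 = "\<lambda>\<omega> p. X1 0 (fst p) (snd p) u \<omega>" and ?x2 = "\<lambda>\<omega> p. X2 0 (fst p) (snd p) u \<omega>"
  note [measurable] = N1.X_random[OF u] N2.X_random[OF u] N1.first_batch_measurable[OF u] N2.first_batch_measurable[OF u]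
  have x_meas: "?x1 \<in> measurable M ?P" "?x2 \<in> measurable M ?P"
    by (auto intro!: measurable_PiM_single')
  have "distr M (count_space UNIV) (X1 0 j l u) = distr M (count_space UNIV) (X2 0 j l u)" for j l
    by (rule measure_eqI_finite[of _ UNIV]) (simp_all add: N1.emeasure_position[OF u] N2.emeasure_position[OF u])
  then have x_law: "distr M ?P ?x1 = distr M ?P ?x2"
    unfolding N1.distr_itineraries[OF u] N2.distr_itineraries[OF u] by simp
  have "N1.expectation (\<lambda>\<omega>. h (census s (\<lambda>(j, l). X1 0 j l u \<omega>))) = N1.expectation (\<lambda>\<omega>. h (census s (\<lambda>(j, l). X2 0 j l u \<omega>)))"
    for s and h :: "_ \<Rightarrow> real"
  proof -
    have "(\<lambda>x. census s x) \<in> measurable ?P (count_space UNIV)"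
      by (rule measurable_census) auto
    from measurable_compose[OF this, of h borel]
    have "(\<lambda>x. h (census s x)) \<in> borel_measurable ?P" by simp
    then show ?thesis
      using integral_distr[OF x_meas(1), of "\<lambda>x. h (census s x)"] integral_distr[OF x_meas(2), of "\<lambda>x. h (census s x)"] x_law
      by (simp add: case_prod_unfold)
  qed
  then have exp_eq: "N1.expectation (\<lambda>\<omega>. h (?B1 \<omega>)) = N1.expectation (\<lambda>\<omega>. h (?B2 \<omega>))"
    if "\<And>x. \<bar>h x\<bar> \<le> 1" for h :: "_ \<Rightarrow> real"
    using N1.expectation_first_batch[OF u, of h 1] N2.expectation_first_batch[OF u, of h 1] that by simp
  show ?thesis
  proof (rule measure_eqI)
    fix A assume "A \<in> sets (distr M (count_space UNIV) ?B1)"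
    have "N1.expectation (indicator (B -` A \<inter> space M)) = N1.expectation (\<lambda>\<omega>. indicator A (B \<omega>) :: real)"
      for B by (rule Bochner_Integration.integral_cong) (auto simp: indicator_def)
    then show "emeasure (distr M (count_space UNIV) ?B1) A = emeasure (distr M (count_space UNIV) ?B2) A"
      using exp_eq[of "indicator A"]
      by (simp add: emeasure_distr N1.emeasure_eq_measure measurable_sets_borel)
  qed simp
qed

text \<open>
  Both means satisfy the renewal equation, and by the induction hypothesis for the two networks after
  their first arrivals the integrands differ by at most \<open>2 * (1 - exp (- lam * t)) ^ n\<close> up to time
  \<open>t\<close>; for a first arrival after \<open>t\<close> both are \<open>f 0\<close>.  The first arrival is before \<open>t\<close> with probability
  \<open>1 - exp (- lam * t)\<close>, which provides one more factor.  The induction has to range over all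
  networks with the given parameters and over all \<open>f\<close>, since it passes to the networks after the
  first arrival and to translates of \<open>f\<close>.
\<close>

lemma mean_difference_le_power:
  assumes N1: "batch_network M lam T1 \<Sigma>1 S X1 q" and N2: "batch_network M lam T2 \<Sigma>2 S X2 q"
    and f: "\<And>x. \<bar>f x\<bar> \<le> 1" and t: "0 \<le> t"
  shows "\<bar>mean_of_lengths M T1 \<Sigma>1 X1 f t - mean_of_lengths M T2 \<Sigma>2 X2 f t\<bar> \<le> 2 * (1 - exp (- lam * t)) ^ n"
  using assms
proof (induction n arbitrary: T1 \<Sigma>1 X1 T2 \<Sigma>2 X2 f t)
  case 0
  interpret N1: batch_network M lam T1 \<Sigma>1 S X1 q by (rule 0)
  interpret N2: batch_network M lam T2 \<Sigma>2 S X2 q by (rule 0)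
  show ?case using N1.abs_mean_le[of f 1 t] N2.abs_mean_le[of f 1 t] 0(3) by simp
next
  case (Suc n)
  interpret N1: batch_network M lam T1 \<Sigma>1 S X1 q by (rule Suc)
  interpret N2: batch_network M lam T2 \<Sigma>2 S X2 q by (rule Suc)
  let ?E = "density lborel (exponential_density lam)"
  interpret E: prob_space ?E using N1.lam_pos by (rule prob_space_exponential_density)
  let ?r = "1 - exp (- lam * t)"
  have close: "\<bar>N1.mean_after_batch f u - N2.mean_after_batch f u\<bar> \<le> 2 * ?r ^ n" if u: "0 \<le> u" "u \<le> t" for u
  proof -
    let ?B = "distr M (count_space UNIV) (N1.first_batch u)"
    interpret B: prob_space ?B by (rule N1.prob_space_distr[OF N1.first_batch_measurable[OF u(1)]])
    let ?m1 = "\<lambda>b. N1.expectation (\<lambda>\<omega>. f (b + N1.later_lengths u \<omega>))"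
    let ?m2 = "\<lambda>b. N1.expectation (\<lambda>\<omega>. f (b + N2.later_lengths u \<omega>))"
    have "N1.mean_after_batch f u = B.expectation ?m1"
      by (rule N1.mean_after_batch_independent[OF Suc.prems(3) u(1)])
    moreover have "N2.mean_after_batch f u = B.expectation ?m2"
      unfolding distr_first_batch_unique[OF Suc.prems(1,2) u(1)]
      by (rule N2.mean_after_batch_independent[OF Suc.prems(3) u(1)])
    moreover have "B.expectation ?m1 - B.expectation ?m2 = B.expectation (\<lambda>b. ?m1 b - ?m2 b)"
      by (rule Bochner_Integration.integral_diff[symmetric])
        (auto intro!: B.integrable_const_bound[of _ 1] N1.abs_expectation_le Suc.prems(3))
    moreover have "\<bar>B.expectation (\<lambda>b. ?m1 b - ?m2 b)\<bar> \<le> 2 * ?r ^ n"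
    proof (rule B.abs_expectation_le)
      fix b
      have "\<bar>?m1 b - ?m2 b\<bar> \<le> 2 * (1 - exp (- lam * u)) ^ n"
        using Suc.IH[OF N1.later_network N2.later_network, of "\<lambda>x. f (b + x)" u] Suc.prems(3) u(1)
        by (simp add: mean_of_lengths_def)
      also have "\<dots> \<le> 2 * ?r ^ n"
        using u N1.lam_pos by (intro mult_left_mono power_mono) auto
      finally show "\<bar>?m1 b - ?m2 b\<bar> \<le> 2 * ?r ^ n" .
    qed
    ultimately show ?thesis by simp
  qed
  let ?D = "\<lambda>s. N1.mean_after_batch f (t - s) - N2.mean_after_batch f (t - s)"
  have int1: "integrable ?E (\<lambda>s. N1.mean_after_batch f (t - s))"
    by (rule E.integrable_const_bound[of _ 1]) (use N1.abs_mean_after_batch_le[of f 1] Suc.prems(3) in auto)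
  have int2: "integrable ?E (\<lambda>s. N2.mean_after_batch f (t - s))"
    by (rule E.integrable_const_bound[of _ 1]) (use N2.abs_mean_after_batch_le[of f 1] Suc.prems(3) in auto)
  have "\<bar>N1.mean f t - N2.mean f t\<bar> = \<bar>E.expectation ?D\<bar>"
    using int1 int2 by (simp add: N1.mean_renewal[OF Suc.prems(3)] N2.mean_renewal[OF Suc.prems(3)])
  also have "\<dots> \<le> E.expectation (\<lambda>s. \<bar>?D s\<bar>)" by (rule integral_abs_bound)
  also have "\<dots> \<le> E.expectation (\<lambda>s. 2 * ?r ^ n * indicator {..t} s)"
  proof (rule integral_mono_AE)
    have "AE s in ?E. 0 \<le> s"
      by (subst AE_density) (auto simp: exponential_density_def)
    then show "AE s in ?E. \<bar>?D s\<bar> \<le> 2 * ?r ^ n * indicator {..t} s"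
    proof eventually_elim
      case (elim s)
      then show ?case
        using close[of "t - s"] by (cases "s \<le> t") (auto simp: N1.mean_after_batch_def N2.mean_after_batch_def)
    qed
  qed (use int1 int2 in \<open>auto simp: E.emeasure_eq_measure intro!: integrable_mult_right integrable_real_indicator\<close>)
  also have "\<dots> = 2 * ?r ^ Suc n"
    using measure_exponential_atMost[OF N1.lam_pos Suc.prems(4)] by simp
  finally show ?case .
qed

lemma mean_of_lengths_unique:
  assumes N1: "batch_network M lam T1 \<Sigma>1 S X1 q" and N2: "batch_network M lam T2 \<Sigma>2 S X2 q"
    and f: "\<And>x. \<bar>f x\<bar> \<le> 1"
  shows "mean_of_lengths M T1 \<Sigma>1 X1 f t = mean_of_lengths M T2 \<Sigma>2 X2 f t"
proof (cases "0 \<le> t")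
  case True
  have "(\<lambda>n. 2 * (1 - exp (- lam * t)) ^ n) \<longlonglongrightarrow> 2 * 0"
    using True batch_network.lam_pos[OF N1]
    by (intro tendsto_mult tendsto_const LIMSEQ_realpow_zero) auto
  then have "\<bar>mean_of_lengths M T1 \<Sigma>1 X1 f t - mean_of_lengths M T2 \<Sigma>2 X2 f t\<bar> \<le> 2 * 0"
    by (rule LIMSEQ_le_const) (use mean_difference_le_power[OF N1 N2 _ True, of f] f in blast)
  then show ?thesis by simp
qed (simp add: mean_of_lengths_def)

text \<open>
  By uniqueness, \<open>mean f u\<close> is also the mean of \<open>f\<close> at the lengths produced by the later batches
  alone, on the same probability space; adding the first batch changes these lengths only if
  something of it remains.
\<close>

lemma (in batch_network) mean_after_batch_near_mean:
  assumes f: "\<And>x. \<bar>f x\<bar> \<le> 1" and u: "u \<ge> 0"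
  shows "\<bar>mean_after_batch f u - mean f u\<bar> \<le> 2 * prob {\<omega> \<in> space M. first_batch u \<omega> \<noteq> 0}"
proof -
  interpret L: batch_network M lam "tail_arrivals T" "\<lambda>i. \<Sigma> (Suc i)" S "\<lambda>i. X (Suc i)" q
    by (rule later_network)
  note [measurable] = first_batch_measurable[OF u]
  have [measurable]: "later_lengths u \<in> measurable M (count_space UNIV)"
    by (rule L.measurable_from_sources[OF L.measurable_queue_lengths_at[OF u]])
  have m1 [measurable]: "(\<lambda>\<omega>. f (first_batch u \<omega> + later_lengths u \<omega>)) \<in> borel_measurable M"
    by (rule measurable_countable_binary[of _ _ _ "\<lambda>b n. f (b + n)"]) simp_all
  have m2 [measurable]: "(\<lambda>\<omega>. f (later_lengths u \<omega>)) \<in> borel_measurable M"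
    by measurable
  have int: "integrable M (\<lambda>\<omega>. f (first_batch u \<omega> + later_lengths u \<omega>))" "integrable M (\<lambda>\<omega>. f (later_lengths u \<omega>))"
    by (auto intro!: integrable_const_bound[of _ 1] f m1 m2)
  have "mean f u = expectation (\<lambda>\<omega>. f (later_lengths u \<omega>))"
    using mean_of_lengths_unique[OF batch_network_axioms later_network, of f u] f u by (simp add: mean_of_lengths_def)
  then have "\<bar>mean_after_batch f u - mean f u\<bar> =
      \<bar>expectation (\<lambda>\<omega>. f (first_batch u \<omega> + later_lengths u \<omega>) - f (later_lengths u \<omega>))\<bar>"
    using int u by (simp add: mean_after_batch_def)
  also have "\<dots> \<le> expectation (\<lambda>\<omega>. \<bar>f (first_batch u \<omega> + later_lengths u \<omega>) - f (later_lengths u \<omega>)\<bar>)"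
    by (rule integral_abs_bound)
  also have "\<dots> \<le> expectation (\<lambda>\<omega>. 2 * indicator {\<omega> \<in> space M. first_batch u \<omega> \<noteq> 0} \<omega>)"
  proof (rule integral_mono)
    fix \<omega> assume "\<omega> \<in> space M"
    then show "\<bar>f (first_batch u \<omega> + later_lengths u \<omega>) - f (later_lengths u \<omega>)\<bar>
        \<le> 2 * indicator {\<omega> \<in> space M. first_batch u \<omega> \<noteq> 0} \<omega>"
      using f[of "first_batch u \<omega> + later_lengths u \<omega>"] f[of "later_lengths u \<omega>"]
      by (cases "first_batch u \<omega> = 0") auto
  qed (use int in \<open>auto simp: emeasure_eq_measure intro!: integrable_real_indicator\<close>)
  also have "\<dots> = 2 * prob {\<omega> \<in> space M. first_batch u \<omega> \<noteq> 0}" by simp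
  finally show ?thesis .
qed

section \<open>Convergence of laws that are uniformly Cauchy\<close>

lemma real_cauchy_at_top_convergent:
  fixes g :: "real \<Rightarrow> real"
  assumes cauchy: "\<And>\<epsilon>. 0 < \<epsilon> \<Longrightarrow> \<exists>a. \<forall>b\<ge>a. \<bar>g b - g a\<bar> \<le> \<epsilon>"
  shows "\<exists>l. (g \<longlongrightarrow> l) at_top"
proof -
  have near: "\<exists>a. \<forall>b\<ge>a. \<forall>c\<ge>a. \<bar>g b - g c\<bar> < \<epsilon>" if "0 < \<epsilon>" for \<epsilon>
  proof -
    obtain a where a: "\<bar>g b - g a\<bar> \<le> \<epsilon> / 3" if "a \<le> b" for b
      using cauchy[of "\<epsilon> / 3"] \<open>0 < \<epsilon>\<close> by auto
    have "\<bar>g b - g c\<bar> < \<epsilon>" if "a \<le> b" "a \<le> c" for b c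
      using a[OF that(1)] a[OF that(2)] \<open>0 < \<epsilon>\<close> by linarith
    then show ?thesis by blast
  qed
  have "Cauchy (\<lambda>n. g (real n))"
  proof (rule CauchyI)
    fix \<epsilon> :: real assume "0 < \<epsilon>"
    then obtain a where a: "\<forall>b\<ge>a. \<forall>c\<ge>a. \<bar>g b - g c\<bar> < \<epsilon>" using near by blast
    obtain N :: nat where "a \<le> real N" using real_arch_simple by blast
    then have "a \<le> real m" if "N \<le> m" for m using that of_nat_le_iff order_trans by blast
    then show "\<exists>N. \<forall>m\<ge>N. \<forall>n\<ge>N. norm (g (real m) - g (real n)) < \<epsilon>"
      using a by (auto intro!: exI[of _ N])
  qed
  then obtain l where l: "(\<lambda>n. g (real n)) \<longlonglongrightarrow> l"
    using Cauchy_convergent convergentD by blast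
  have "(g \<longlongrightarrow> l) at_top"
  proof (rule tendstoI)
    fix \<epsilon> :: real assume "0 < \<epsilon>"
    then obtain a where a: "\<forall>b\<ge>a. \<forall>c\<ge>a. \<bar>g b - g c\<bar> < \<epsilon> / 2" using near[of "\<epsilon> / 2"] by auto
    have "\<forall>\<^sub>F n in sequentially. a \<le> real n"
      using filterlim_real_sequentially by (simp add: filterlim_at_top)
    moreover have "\<forall>\<^sub>F n in sequentially. dist (g (real n)) l < \<epsilon> / 2"
      using l \<open>0 < \<epsilon>\<close> by (intro tendstoD) auto
    ultimately have "\<forall>\<^sub>F n in sequentially. a \<le> real n \<and> dist (g (real n)) l < \<epsilon> / 2"
      by eventually_elim simp
    then obtain n where n: "a \<le> real n" "dist (g (real n)) l < \<epsilon> / 2"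
      using eventually_happens by force
    show "\<forall>\<^sub>F b in at_top. dist (g b) l < \<epsilon>"
      using eventually_ge_at_top[of a]
    proof eventually_elim
      case (elim b)
      then have "\<bar>g b - g (real n)\<bar> < \<epsilon> / 2" using a n(1) by blast
      then show ?case using n(2) unfolding dist_real_def by linarith
    qed
  qed
  then show ?thesis by blast
qed

text \<open>
  Applied both to the laws of a process and to their limit, this reduces convergence of the mean of a
  bounded function to convergence of finitely many point probabilities.
\<close>

lemma (in prob_space) expectation_finite_approx:
  fixes Z :: "'a \<Rightarrow> 'b" and f :: "'b \<Rightarrow> real"
  assumes Z [measurable]: "Z \<in> measurable M (count_space UNIV)" and K: "finite K" and f: "\<And>x. \<bar>f x\<bar> \<le> c"
  shows "\<bar>expectation (\<lambda>\<omega>. f (Z \<omega>)) - (\<Sum>x\<in>K. f x * prob {\<omega> \<in> space M. Z \<omega> = x})\<bar>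
      \<le> c * (1 - (\<Sum>x\<in>K. prob {\<omega> \<in> space M. Z \<omega> = x}))"
proof -
  let ?I = "\<lambda>x \<omega>. indicator {\<omega> \<in> space M. Z \<omega> = x} \<omega> :: real"
  have ev [measurable]: "{\<omega> \<in> space M. Z \<omega> = x} \<in> events" for x
    by measurable
  have I_int: "integrable M (?I x)" for x
    by (rule integrable_real_indicator) (auto simp: emeasure_eq_measure)
  have f_int: "integrable M (\<lambda>\<omega>. f (Z \<omega>))"
    by (rule integrable_const_bound[of _ c])
      (use f measurable_compose[OF Z, of f borel] in simp_all)
  have sum_I: "(\<Sum>x\<in>K. h x * ?I x \<omega>) = (if Z \<omega> \<in> K then h (Z \<omega>) else 0)" if "\<omega> \<in> space M" for h :: "'b \<Rightarrow> real" and \<omega>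
  proof -
    have "(\<Sum>x\<in>K. h x * ?I x \<omega>) = (\<Sum>x\<in>K. if x = Z \<omega> then h x else 0)"
      using that by (intro sum.cong) (auto simp: indicator_def)
    then show ?thesis using K by simp
  qed
  have "expectation (\<lambda>\<omega>. f (Z \<omega>)) - (\<Sum>x\<in>K. f x * prob {\<omega> \<in> space M. Z \<omega> = x})
      = expectation (\<lambda>\<omega>. f (Z \<omega>) - (\<Sum>x\<in>K. f x * ?I x \<omega>))"
    using f_int I_int by (simp add: integral_sum Int_absorb2)
  also have "\<bar>\<dots>\<bar> \<le> expectation (\<lambda>\<omega>. \<bar>f (Z \<omega>) - (\<Sum>x\<in>K. f x * ?I x \<omega>)\<bar>)"
    by (rule integral_abs_bound)
  also have "\<dots> \<le> expectation (\<lambda>\<omega>. c * (1 - (\<Sum>x\<in>K. 1 * ?I x \<omega>)))"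
  proof (rule integral_mono)
    fix \<omega> assume "\<omega> \<in> space M"
    then show "\<bar>f (Z \<omega>) - (\<Sum>x\<in>K. f x * ?I x \<omega>)\<bar> \<le> c * (1 - (\<Sum>x\<in>K. 1 * ?I x \<omega>))"
      unfolding sum_I[OF \<open>\<omega> \<in> space M\<close>] using f[of "Z \<omega>"] by simp
  qed (use f_int I_int in \<open>auto intro!: integrable_abs integrable_diff integrable_sum integrable_mult_right\<close>)
  also have "\<dots> = c * (1 - (\<Sum>x\<in>K. prob {\<omega> \<in> space M. Z \<omega> = x}))"
    using I_int by (simp add: integral_sum prob_space Int_absorb2)
  finally show ?thesis .
qed

lemma (in prob_space) law_concentrated_on_finite:
  fixes Z :: "'a \<Rightarrow> 'b::countable"
  assumes Z [measurable]: "Z \<in> measurable M (count_space UNIV)" and "0 < \<epsilon>"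
  shows "\<exists>K. finite K \<and> 1 - \<epsilon> < prob {\<omega> \<in> space M. Z \<omega> \<in> K}"
proof -
  let ?K = "\<lambda>n. {x :: 'b. to_nat x \<le> n}"
  have fin: "finite (?K n)" for n
    using finite_vimageI[of "{..n}" "to_nat :: 'b \<Rightarrow> nat"] by (simp add: vimage_def)
  have "(\<lambda>n. prob {\<omega> \<in> space M. Z \<omega> \<in> ?K n}) \<longlonglongrightarrow> prob (\<Union>n. {\<omega> \<in> space M. Z \<omega> \<in> ?K n})"
    by (rule finite_Lim_measure_incseq) (auto simp: incseq_def)
  also have "(\<Union>n. {\<omega> \<in> space M. Z \<omega> \<in> ?K n}) = space M" by auto
  finally have "\<forall>\<^sub>F n in sequentially. 1 - \<epsilon> < prob {\<omega> \<in> space M. Z \<omega> \<in> ?K n}"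
    using \<open>0 < \<epsilon>\<close> by (intro order_tendstoD) (auto simp: prob_space)
  then obtain n where "1 - \<epsilon> < prob {\<omega> \<in> space M. Z \<omega> \<in> ?K n}"
    using eventually_happens by force
  then show ?thesis using fin by blast
qed

lemma (in prob_space) prob_in_finite:
  assumes [measurable]: "Z \<in> measurable M (count_space UNIV)" and "finite K"
  shows "prob {\<omega> \<in> space M. Z \<omega> \<in> K} = (\<Sum>x\<in>K. prob {\<omega> \<in> space M. Z \<omega> = x})"
proof -
  have "{\<omega> \<in> space M. Z \<omega> \<in> K} = (\<Union>x\<in>K. {\<omega> \<in> space M. Z \<omega> = x})" by auto
  then show ?thesis
    using \<open>finite K\<close> by (auto intro!: finite_measure_finite_Union simp: disjoint_family_on_def)
qed

lemma pmf_with_weights_exists: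
  fixes p :: "'b::countable \<Rightarrow> real"
  assumes nonneg: "\<And>x. 0 \<le> p x" and le: "\<And>K. finite K \<Longrightarrow> sum p K \<le> 1"
    and ge: "\<And>\<epsilon>. 0 < \<epsilon> \<Longrightarrow> \<exists>K. finite K \<and> 1 - \<epsilon> \<le> sum p K"
  shows "\<exists>\<pi>. \<forall>x. pmf \<pi> x = p x"
proof -
  let ?K = "\<lambda>n. {x :: 'b. to_nat x \<le> n}"
  have fin: "finite (?K n)" for n
    using finite_vimageI[of "{..n}" "to_nat :: 'b \<Rightarrow> nat"] by (simp add: vimage_def)
  have part: "(\<integral>\<^sup>+x. ennreal (p x) * indicator K x \<partial>count_space UNIV) = ennreal (sum p K)" if "finite K" for K
  proof -
    have "(\<integral>\<^sup>+x. ennreal (p x) * indicator K x \<partial>count_space UNIV) = (\<Sum>x\<in>K. ennreal (p x) * indicator K x)"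
      using that by (intro nn_integral_count_space') auto
    also have "\<dots> = (\<Sum>x\<in>K. ennreal (p x))" by (intro sum.cong) auto
    finally show ?thesis using nonneg by (simp add: sum_ennreal)
  qed
  have "(\<integral>\<^sup>+x. ennreal (p x) \<partial>count_space UNIV) = 1"
  proof (rule antisym)
    have "(\<integral>\<^sup>+x. ennreal (p x) \<partial>count_space UNIV) = (\<integral>\<^sup>+x. (SUP n. ennreal (p x) * indicator (?K n) x) \<partial>count_space UNIV)"
    proof (rule nn_integral_cong)
      fix x :: 'b
      show "ennreal (p x) = (SUP n. ennreal (p x) * indicator (?K n) x)"
      proof (rule antisym)
        show "ennreal (p x) \<le> (SUP n. ennreal (p x) * indicator (?K n) x)"
          by (rule SUP_upper2[of "to_nat x"]) auto
        show "(SUP n. ennreal (p x) * indicator (?K n) x) \<le> ennreal (p x)"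
          by (rule SUP_least) (auto split: split_indicator)
      qed
    qed
    also have "\<dots> = (SUP n. \<integral>\<^sup>+x. ennreal (p x) * indicator (?K n) x \<partial>count_space UNIV)"
      by (intro nn_integral_monotone_convergence_SUP) (auto simp: incseq_def le_fun_def split: split_indicator)
    also have "\<dots> \<le> 1"
      using le fin by (intro SUP_least) (simp add: part)
    finally show "(\<integral>\<^sup>+x. ennreal (p x) \<partial>count_space UNIV) \<le> 1" .
  next
    show "1 \<le> (\<integral>\<^sup>+x. ennreal (p x) \<partial>count_space UNIV)"
    proof (rule ennreal_le_epsilon)
      fix \<epsilon> :: real assume "0 < \<epsilon>"
      then obtain K where K: "finite K" "1 - \<epsilon> \<le> sum p K" using ge by blast
      have "ennreal (sum p K) \<le> (\<integral>\<^sup>+x. ennreal (p x) \<partial>count_space UNIV)"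
        unfolding part[OF K(1), symmetric] by (intro nn_integral_mono) (auto split: split_indicator)
      then have "ennreal (sum p K) + ennreal \<epsilon> \<le> (\<integral>\<^sup>+x. ennreal (p x) \<partial>count_space UNIV) + ennreal \<epsilon>"
        by (rule add_right_mono)
      moreover have "1 \<le> ennreal (sum p K) + ennreal \<epsilon>"
        using K(2) \<open>0 < \<epsilon>\<close> nonneg by (simp add: ennreal_plus[symmetric] sum_nonneg del: ennreal_plus)
      ultimately show "1 \<le> (\<integral>\<^sup>+x. ennreal (p x) \<partial>count_space UNIV) + ennreal \<epsilon>" by (rule order_trans[rotated])
    qed
  qed
  then have "pmf (embed_pmf p) x = p x" for x
    using nonneg by (intro pmf_embed_pmf) auto
  then show ?thesis by blast
qed

text \<open>
  The point probabilities converge.  Uniformity over \<open>f\<close> makes the laws tight: a finite set that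
  carries most of the law at one sufficiently late time does so at all later times.  Hence the limits
  of the point probabilities add up to \<open>1\<close>, and up to a small error the mean of a bounded function
  is a finite sum.
\<close>

lemma (in prob_space) uniformly_cauchy_laws_converge:
  fixes Y :: "real \<Rightarrow> 'a \<Rightarrow> 'b::countable"
  assumes meas: "\<And>t. 0 \<le> t \<Longrightarrow> Y t \<in> measurable M (count_space UNIV)"
    and cauchy: "\<And>\<epsilon>. 0 < \<epsilon> \<Longrightarrow> \<exists>a\<ge>0. \<forall>b\<ge>a. \<forall>f :: 'b \<Rightarrow> real. (\<forall>x. \<bar>f x\<bar> \<le> 1) \<longrightarrow>
      \<bar>expectation (\<lambda>\<omega>. f (Y b \<omega>)) - expectation (\<lambda>\<omega>. f (Y a \<omega>))\<bar> \<le> \<epsilon>"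
  shows "\<exists>\<pi> :: 'b pmf. \<forall>f :: 'b \<Rightarrow> real. bounded (range f) \<longrightarrow>
    ((\<lambda>t. expectation (\<lambda>\<omega>. f (Y t \<omega>))) \<longlongrightarrow> (\<integral>y. f y \<partial>measure_pmf \<pi>)) at_top"
proof -
  let ?P = "\<lambda>t x. prob {\<omega> \<in> space M. Y t \<omega> = x}"
  have prob_eq: "prob {\<omega> \<in> space M. Y t \<omega> \<in> A} = expectation (\<lambda>\<omega>. indicator A (Y t \<omega>))" for t A
  proof -
    have "expectation (\<lambda>\<omega>. indicator A (Y t \<omega>) :: real) = expectation (indicator {\<omega> \<in> space M. Y t \<omega> \<in> A})"
      by (rule Bochner_Integration.integral_cong) (auto simp: indicator_def)
    then show ?thesis by (simp add: Int_absorb2)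
  qed
  have prob_cauchy: "\<exists>a\<ge>0. \<forall>b\<ge>a. \<forall>A. \<bar>prob {\<omega> \<in> space M. Y b \<omega> \<in> A} - prob {\<omega> \<in> space M. Y a \<omega> \<in> A}\<bar> \<le> \<epsilon>"
    if "0 < \<epsilon>" for \<epsilon>
  proof -
    obtain a where a: "0 \<le> a" "\<And>b f. a \<le> b \<Longrightarrow> (\<forall>x :: 'b. \<bar>f x\<bar> \<le> 1) \<Longrightarrow>
        \<bar>expectation (\<lambda>\<omega>. f (Y b \<omega>)) - expectation (\<lambda>\<omega>. f (Y a \<omega>))\<bar> \<le> \<epsilon>"
      using cauchy[OF \<open>0 < \<epsilon>\<close>] by blast
    have "\<bar>prob {\<omega> \<in> space M. Y b \<omega> \<in> A} - prob {\<omega> \<in> space M. Y a \<omega> \<in> A}\<bar> \<le> \<epsilon>" if "a \<le> b" for b A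
      unfolding prob_eq by (rule a(2)[OF that]) simp
    then show ?thesis using a(1) by blast
  qed
  have "\<exists>l. ((\<lambda>t. ?P t x) \<longlongrightarrow> l) at_top" for x
  proof (rule real_cauchy_at_top_convergent)
    fix \<epsilon> :: real assume "0 < \<epsilon>"
    then obtain a where "\<forall>b\<ge>a. \<forall>A. \<bar>prob {\<omega> \<in> space M. Y b \<omega> \<in> A} - prob {\<omega> \<in> space M. Y a \<omega> \<in> A}\<bar> \<le> \<epsilon>"
      using prob_cauchy by blast
    then have "\<bar>prob {\<omega> \<in> space M. Y b \<omega> \<in> {x}} - prob {\<omega> \<in> space M. Y a \<omega> \<in> {x}}\<bar> \<le> \<epsilon>" if "a \<le> b" for b
      using that by blast
    then show "\<exists>a. \<forall>b\<ge>a. \<bar>?P b x - ?P a x\<bar> \<le> \<epsilon>" by auto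
  qed
  then obtain p where p: "((\<lambda>t. ?P t x) \<longlongrightarrow> p x) at_top" for x by metis
  have p_sum: "((\<lambda>t. \<Sum>x\<in>K. h x * ?P t x) \<longlongrightarrow> (\<Sum>x\<in>K. h x * p x)) at_top" for K and h :: "'b \<Rightarrow> real"
    by (intro tendsto_sum tendsto_mult tendsto_const p)
  have tight: "\<exists>K a. finite K \<and> 0 \<le> a \<and> (\<forall>b\<ge>a. 1 - \<epsilon> \<le> (\<Sum>x\<in>K. ?P b x))" if "0 < \<epsilon>" for \<epsilon>
  proof -
    obtain a where a: "0 \<le> a"
      "\<And>b A. a \<le> b \<Longrightarrow> \<bar>prob {\<omega> \<in> space M. Y b \<omega> \<in> A} - prob {\<omega> \<in> space M. Y a \<omega> \<in> A}\<bar> \<le> \<epsilon> / 2"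
      using prob_cauchy[of "\<epsilon> / 2"] \<open>0 < \<epsilon>\<close> by auto
    obtain K where K: "finite K" "1 - \<epsilon> / 2 < prob {\<omega> \<in> space M. Y a \<omega> \<in> K}"
      using law_concentrated_on_finite[OF meas[OF a(1)], of "\<epsilon> / 2"] \<open>0 < \<epsilon>\<close> by auto
    have "1 - \<epsilon> \<le> (\<Sum>x\<in>K. ?P b x)" if "a \<le> b" for b
      using a(2)[OF that, of K] K(2) prob_in_finite[OF meas K(1), of b] that a(1) by linarith
    then show ?thesis using K(1) a(1) by blast
  qed
  have p_le: "sum p K \<le> 1" if "finite K" for K
  proof (rule tendsto_upperbound)
    show "((\<lambda>t. \<Sum>x\<in>K. ?P t x) \<longlongrightarrow> sum p K) at_top" using p_sum[of "\<lambda>_. 1"] by simp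
    show "\<forall>\<^sub>F t in at_top. (\<Sum>x\<in>K. ?P t x) \<le> 1"
      using eventually_ge_at_top[of 0]
    proof eventually_elim
      case (elim t)
      then show ?case using prob_in_finite[OF meas that, of t] prob_le_1 by metis
    qed
  qed simp
  have p_ge: "\<exists>K a. finite K \<and> 0 \<le> a \<and> (\<forall>b\<ge>a. 1 - \<epsilon> \<le> (\<Sum>x\<in>K. ?P b x)) \<and> 1 - \<epsilon> \<le> sum p K" if "0 < \<epsilon>" for \<epsilon>
  proof -
    obtain K a where Ka: "finite K" "0 \<le> a" "\<forall>b\<ge>a. 1 - \<epsilon> \<le> (\<Sum>x\<in>K. ?P b x)" using tight[OF \<open>0 < \<epsilon>\<close>] by blast
    have "1 - \<epsilon> \<le> sum p K"
    proof (rule tendsto_lowerbound)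
      show "((\<lambda>t. \<Sum>x\<in>K. ?P t x) \<longlongrightarrow> sum p K) at_top" using p_sum[of "\<lambda>_. 1"] by simp
      show "\<forall>\<^sub>F t in at_top. 1 - \<epsilon> \<le> (\<Sum>x\<in>K. ?P t x)"
        using eventually_ge_at_top[of a] by eventually_elim (use Ka(3) in blast)
    qed simp
    then show ?thesis using Ka by blast
  qed
  have "0 \<le> p x" for x
    by (rule tendsto_lowerbound[OF p]) auto
  then have "\<exists>\<pi>. \<forall>x. pmf \<pi> x = p x"
    using p_le p_ge by (intro pmf_with_weights_exists) blast+
  then obtain \<pi> where \<pi>: "\<And>x. pmf \<pi> x = p x" by blast
  have "((\<lambda>t. expectation (\<lambda>\<omega>. f (Y t \<omega>))) \<longlongrightarrow> (\<integral>y. f y \<partial>measure_pmf \<pi>)) at_top"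
    if "bounded (range f)" for f :: "'b \<Rightarrow> real"
  proof (rule tendstoI)
    fix \<epsilon> :: real assume \<epsilon>: "0 < \<epsilon>"
    obtain c where c: "0 < c" "\<And>x. \<bar>f x\<bar> \<le> c"
      using \<open>bounded (range f)\<close> unfolding bounded_pos by auto
    \<comment> \<open>The mass outside \<open>K\<close>, at late times and in the limit, contributes at most \<open>\<epsilon> / 3\<close> each.\<close>
    define \<eta> where "\<eta> = \<epsilon> / (3 * c)"
    have \<eta>: "0 < \<eta>" "c * \<eta> = \<epsilon> / 3" using \<epsilon> c(1) by (auto simp: \<eta>_def)
    obtain K a where Ka: "finite K" "0 \<le> a" "\<forall>b\<ge>a. 1 - \<eta> \<le> (\<Sum>x\<in>K. ?P b x)" "1 - \<eta> \<le> sum p K"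
      using p_ge[OF \<eta>(1)] by blast
    have small: "c * (1 - s) \<le> \<epsilon> / 3" if "1 - \<eta> \<le> s" for s
      unfolding \<eta>(2)[symmetric] using that c(1) by (intro mult_left_mono) auto
    have "\<bar>(\<integral>y. f y \<partial>measure_pmf \<pi>) - (\<Sum>x\<in>K. f x * p x)\<bar> \<le> c * (1 - sum p K)"
      using measure_pmf.expectation_finite_approx[of "\<lambda>x. x" \<pi> K f c] Ka(1) c(2)
      by (simp add: measure_pmf_single \<pi>)
    then have lim: "\<bar>(\<integral>y. f y \<partial>measure_pmf \<pi>) - (\<Sum>x\<in>K. f x * p x)\<bar> \<le> \<epsilon> / 3"
      using small[OF Ka(4)] by linarith
    have "\<forall>\<^sub>F t in at_top. dist (\<Sum>x\<in>K. f x * ?P t x) (\<Sum>x\<in>K. f x * p x) < \<epsilon> / 3"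
      using p_sum \<epsilon> by (intro tendstoD) auto
    then show "\<forall>\<^sub>F t in at_top. dist (expectation (\<lambda>\<omega>. f (Y t \<omega>))) (\<integral>y. f y \<partial>measure_pmf \<pi>) < \<epsilon>"
      using eventually_ge_at_top[of a]
    proof eventually_elim
      case (elim t)
      have "\<bar>expectation (\<lambda>\<omega>. f (Y t \<omega>)) - (\<Sum>x\<in>K. f x * ?P t x)\<bar> \<le> c * (1 - (\<Sum>x\<in>K. ?P t x))"
        using elim(2) Ka(1,2) c(2) by (intro expectation_finite_approx meas) auto
      also have "\<dots> \<le> \<epsilon> / 3" using Ka(3) elim(2) by (intro small) blast
      finally show ?case using lim elim(1) unfolding dist_real_def by linarith
    qed
  qed
  then show ?thesis by blast
qed

section \<open>Ergodicity\<close>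

context batch_network
begin

text \<open>
  The right-hand side does not depend on \<open>b\<close> or \<open>f\<close> and tends to \<open>0\<close> as \<open>a\<close> grows.
\<close>

lemma mean_increment_le:
  assumes \<delta>: "0 < \<delta>" and tails: "\<And>\<tau> j. t\<^sub>0 \<le> \<tau> \<Longrightarrow> occupancy_tail q j \<tau> \<le> exp (- \<delta> * \<tau>)"
    and log: "integrable M (\<lambda>\<omega>. ln (real (\<Sum>j\<in>UNIV. S \<omega> $ j) + 1))"
    and a: "0 \<le> a" "t\<^sub>0 \<le> a" and b: "a \<le> b" and f: "\<And>x. \<bar>f x\<bar> \<le> 1"
  shows "\<bar>mean f b - mean f a\<bar> \<le> 2 * lam * (LINT u:{a<..}|lborel. indicator {0..} u *
    expectation (\<lambda>\<omega>. min 1 (real (\<Sum>j\<in>UNIV. S \<omega> $ j) * exp (- \<delta> * u))))"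
proof -
  let ?p = "\<lambda>u. indicator {0..} u * expectation (\<lambda>\<omega>. min 1 (real (\<Sum>j\<in>UNIV. S \<omega> $ j) * exp (- \<delta> * u)))"
  let ?d = "\<lambda>u. mean_after_batch f u - mean f u"
  have "(\<lambda>\<omega>. real (\<Sum>j\<in>UNIV. S \<omega> $ j)) \<in> borel_measurable M"
    by (rule measurable_compose[OF S_random]) simp
  then have p_int: "integrable lborel ?p"
    by (rule integrable_expected_truncated_exponential[OF \<delta> _ _ log]) (rule of_nat_0_le_iff)
  have p_nonneg: "0 \<le> ?p u" for u
    by (intro mult_nonneg_nonneg integral_nonneg) (simp_all add: sum_nonneg del: of_nat_sum)
  note increment = exponential_renewal_increment[OF lam_pos mean_after_batch_measurable
      abs_mean_after_batch_le[of f 1, OF f] mean_renewal[of f 1, OF f] b]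
  have d_int: "integrable lborel (\<lambda>u. indicator {a<..b} u *\<^sub>R ?d u)"
    using increment(1) by (simp add: set_integrable_def)
  have "\<bar>LINT u:{a<..b}|lborel. ?d u\<bar> \<le> (\<integral>u. \<bar>indicator {a<..b} u *\<^sub>R ?d u\<bar> \<partial>lborel)"
    unfolding set_lebesgue_integral_def by (rule integral_abs_bound)
  also have "\<dots> \<le> (\<integral>u. 2 * (indicator {a<..} u * ?p u) \<partial>lborel)"
  proof (rule integral_mono)
    show "integrable lborel (\<lambda>u. \<bar>indicator {a<..b} u *\<^sub>R ?d u\<bar>)" by (rule integrable_abs[OF d_int])
    show "integrable lborel (\<lambda>u. 2 * (indicator {a<..} u * ?p u))"
      using integrable_mult_indicator[OF _ p_int, of "{a<..}"] by (intro integrable_mult_right) simp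
    fix u
    show "\<bar>indicator {a<..b} u *\<^sub>R ?d u\<bar> \<le> 2 * (indicator {a<..} u * ?p u)"
    proof (cases "u \<in> {a<..b}")
      case True
      then have u: "0 \<le> u" "t\<^sub>0 \<le> u" using a by auto
      have "\<bar>?d u\<bar> \<le> 2 * prob {\<omega> \<in> space M. first_batch u \<omega> \<noteq> 0}"
        by (rule mean_after_batch_near_mean[OF f u(1)])
      also have "prob {\<omega> \<in> space M. first_batch u \<omega> \<noteq> 0} \<le> ?p u"
        using prob_first_batch_nonzero[OF u(1) tails[OF u(2)]] u(1) by simp
      finally show ?thesis using True by simp
    next
      case False
      then show ?thesis using p_nonneg[of u] by (simp add: zero_le_mult_iff)
    qed
  qed
  also have "\<dots> = 2 * (LINT u:{a<..}|lborel. ?p u)"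
    by (simp add: set_lebesgue_integral_def)
  finally have "lam * \<bar>LINT u:{a<..b}|lborel. ?d u\<bar> \<le> lam * (2 * (LINT u:{a<..}|lborel. ?p u))"
    using lam_pos by (intro mult_left_mono) auto
  then show ?thesis
    unfolding increment(2) using lam_pos by (simp add: abs_mult mult_ac)
qed

end

theorem corollary4p1p2:
  fixes M :: "'w measure"
    and lam :: real
    and T :: "nat \<Rightarrow> 'w \<Rightarrow> real"
    and \<Sigma> :: "nat \<Rightarrow> 'w \<Rightarrow> nat ^ 'j::finite"
    and S :: "'w \<Rightarrow> nat ^ 'j"
    and X :: "nat \<Rightarrow> 'j \<Rightarrow> nat \<Rightarrow> real \<Rightarrow> 'w \<Rightarrow> 'j option"
    and q :: "'j \<Rightarrow> 'j \<Rightarrow> real \<Rightarrow> real"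
  assumes network: "batch_network M lam T \<Sigma> S X q"
    and tails: "\<exists>\<delta>>0. \<exists>t\<^sub>0>0. \<forall>\<tau>\<ge>t\<^sub>0. \<forall>j. occupancy_tail q j \<tau> \<le> exp (- \<delta> * \<tau>)"
    and log_moment: "integrable M (\<lambda>\<omega>. ln (real (\<Sum>j\<in>UNIV. S \<omega> $ j) + 1))"
  shows "ergodic M T \<Sigma> X"
proof -
  interpret batch_network M lam T \<Sigma> S X q by (rule network)
  obtain \<delta> t\<^sub>0 where \<delta>: "0 < \<delta>" and t\<^sub>0: "0 < t\<^sub>0"
    and tail: "\<And>\<tau> j. t\<^sub>0 \<le> \<tau> \<Longrightarrow> occupancy_tail q j \<tau> \<le> exp (- \<delta> * \<tau>)"
    using tails by blast
  let ?p = "\<lambda>u. indicator {0..} u * expectation (\<lambda>\<omega>. min 1 (real (\<Sum>j\<in>UNIV. S \<omega> $ j) * exp (- \<delta> * u)))"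
  let ?R = "\<lambda>a. 2 * lam * (LINT u:{a<..}|lborel. ?p u)"
  have meas: "queue_lengths T \<Sigma> X t \<in> measurable M (count_space UNIV)" if "0 \<le> t" for t
    by (rule measurable_from_sources[OF measurable_queue_lengths_at[OF that]])
  have "(\<lambda>\<omega>. real (\<Sum>j\<in>UNIV. S \<omega> $ j)) \<in> borel_measurable M"
    by (rule measurable_compose[OF S_random]) simp
  then have "integrable lborel ?p"
    by (rule integrable_expected_truncated_exponential[OF \<delta> _ _ log_moment]) (rule of_nat_0_le_iff)
  then have R: "(?R \<longlongrightarrow> 2 * lam * 0) at_top"
    by (intro tendsto_mult tendsto_const tail_integral_tendsto_0)
  have "\<exists>\<pi> :: (nat ^ 'j) pmf. \<forall>f :: nat ^ 'j \<Rightarrow> real. bounded (range f) \<longrightarrow>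
    ((\<lambda>t. expectation (\<lambda>\<omega>. f (queue_lengths T \<Sigma> X t \<omega>))) \<longlongrightarrow> (\<integral>y. f y \<partial>measure_pmf \<pi>)) at_top"
  proof (rule uniformly_cauchy_laws_converge[OF meas])
    fix \<epsilon> :: real assume "0 < \<epsilon>"
    then have "\<forall>\<^sub>F a in at_top. ?R a < \<epsilon>"
      using R by (intro order_tendstoD) auto
    moreover have "\<forall>\<^sub>F a in at_top. t\<^sub>0 \<le> a" by (rule eventually_ge_at_top)
    ultimately have "\<forall>\<^sub>F a in at_top. ?R a < \<epsilon> \<and> t\<^sub>0 \<le> a" by eventually_elim simp
    then obtain a where a: "?R a < \<epsilon>" "t\<^sub>0 \<le> a" using eventually_happens by force
    have "\<bar>expectation (\<lambda>\<omega>. f (queue_lengths T \<Sigma> X b \<omega>)) - expectation (\<lambda>\<omega>. f (queue_lengths T \<Sigma> X a \<omega>))\<bar> \<le> \<epsilon>"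
      if "a \<le> b" "\<forall>x. \<bar>f x\<bar> \<le> 1" for b f
    proof -
      have "\<bar>mean f b - mean f a\<bar> \<le> ?R a"
        using a(2) t\<^sub>0 that by (intro mean_increment_le[OF \<delta> tail log_moment]) auto
      then show ?thesis using a t\<^sub>0 that(1) by (simp add: mean_of_lengths_def)
    qed
    then show "\<exists>a\<ge>0. \<forall>b\<ge>a. \<forall>f :: nat ^ 'j \<Rightarrow> real. (\<forall>x. \<bar>f x\<bar> \<le> 1) \<longrightarrow>
      \<bar>expectation (\<lambda>\<omega>. f (queue_lengths T \<Sigma> X b \<omega>)) - expectation (\<lambda>\<omega>. f (queue_lengths T \<Sigma> X a \<omega>))\<bar> \<le> \<epsilon>"
      using a(2) t\<^sub>0 by (intro exI[of _ a]) auto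
  qed
  moreover have "queue_lengths T \<Sigma> X t \<in> borel_measurable M" if "0 \<le> t" for t
    using measurable_compose[OF meas[OF that], of "\<lambda>x. x" borel] by simp
  ultimately show ?thesis
    unfolding ergodic_def converges_in_distribution_def by blast
qed

end
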